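(* Let $R$ be a ring and let $G$ be a non-trivial group. (1) If the group ring $RG$ is generalized $t$-fine (respectively, generalized fine), then $R$ is generalized $t$-fine (respectively, generalized fine) and $G$ is a $p$-group for some prime $p$ with $p\in \mathrm{J}(R)$. (2) If $R$ is generalized $t$-fine (respectively, generalized fine) and $G$ is a locally finite $p$-group for some prime $p$ with $p\in \mathrm{Nil}(R)$, then $RG$ is generalized $t$-fine (respectively, generalized fine).
   Context: Rings are associative with identity $1$ (not necessarily commutative). For a ring $R$: $\mathrm{J}(R)$ is the Jacobson radical, $\mathrm{Nil}(R)$ the set of nilpotent elements, $\mathcal{U}(R)$ the group of units, and $\mathcal{T}(R)$ the set of torsion units, i.e. units $u$ with $u^m=1$ for some $m\ge 1$. $R$ is generalized $t$-fine if $R\setminus \mathrm{J}(R)=\mathcal{T}(R)+\mathrm{Nil}(R)$, and generalized fine if $R\setminus \mathrm{J}(R)=\mathcal{U}(R)+\mathrm{Nil}(R)$. For a prime $p$, "$p\in \mathrm{J}(R)$" and "$p\in \mathrm{Nil}(R)$" refer to the element $p\cdot 1_R$. A $p$-group is a (possibly infinite) group in which every element has order a power of $p$. A group is locally finite if each of its finitely generated subgroups is finite. *)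

theory Defs
  imports "HOL-Computational_Algebra.Primes" "HOL-Algebra.Multiplicative_Group"
    "HOL-Algebra.Generated_Groups"
    "HOL-Algebra.Ideal"
begin

(* HOL-Algebra's maximalideal is two-sided; over a noncommutative ring the
   Jacobson radical needs one-sided ideals. *)

locale left_ideal = additive_subgroup I R + ring R for I and R (structure) +
  assumes I_l_closed: "\<lbrakk>a \<in> I; x \<in> carrier R\<rbrakk> \<Longrightarrow> x \<otimes> a \<in> I"

locale maximal_left_ideal = left_ideal +
  assumes I_notcarr: "carrier R \<noteq> I"
    and I_maximal: "\<lbrakk>left_ideal J R; I \<subseteq> J; J \<subseteq> carrier R\<rbrakk> \<Longrightarrow> (J = I) \<or> (J = carrier R)"

(* The intersection is taken inside the carrier, so the radical of the zero ring
   (which has no maximal left ideals) is the whole ring. *)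
definition jacobson_radical :: "('a, 'm) ring_scheme \<Rightarrow> 'a set" where
  "jacobson_radical R = {x \<in> carrier R. \<forall>M. maximal_left_ideal M R \<longrightarrow> x \<in> M}"

definition nilpotents :: "('a, 'm) ring_scheme \<Rightarrow> 'a set" where
  "nilpotents R = {x \<in> carrier R. \<exists>n::nat. n \<ge> 1 \<and> x [^]\<^bsub>R\<^esub> n = \<zero>\<^bsub>R\<^esub>}"

definition torsion_units :: "('a, 'm) ring_scheme \<Rightarrow> 'a set" where
  "torsion_units R = {u \<in> Units R. \<exists>m::nat. m \<ge> 1 \<and> u [^]\<^bsub>R\<^esub> m = \<one>\<^bsub>R\<^esub>}"

definition generalized_t_fine :: "('a, 'm) ring_scheme \<Rightarrow> bool" where
  "generalized_t_fine R \<longleftrightarrow>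
     carrier R - jacobson_radical R = torsion_units R <+>\<^bsub>R\<^esub> nilpotents R"

definition generalized_fine :: "('a, 'm) ring_scheme \<Rightarrow> bool" where
  "generalized_fine R \<longleftrightarrow>
     carrier R - jacobson_radical R = Units R <+>\<^bsub>R\<^esub> nilpotents R"

(* ord x = 0 encodes infinite order, which is not a power of a prime p. *)
definition p_group :: "nat \<Rightarrow> ('g, 'm) monoid_scheme \<Rightarrow> bool" where
  "p_group p G \<longleftrightarrow> (\<forall>x \<in> carrier G. \<exists>k::nat. group.ord G x = p ^ k)"

definition locally_finite :: "('g, 'm) monoid_scheme \<Rightarrow> bool" where
  "locally_finite G \<longleftrightarrow>
     (\<forall>S. S \<subseteq> carrier G \<longrightarrow> finite S \<longrightarrow> finite (generate G S))"

definition coeff_support :: "('a, 'm) ring_scheme \<Rightarrow> ('g, 'n) monoid_scheme \<Rightarrow> ('g \<Rightarrow> 'a) \<Rightarrow> 'g set" where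
  "coeff_support R G f = {g \<in> carrier G. f g \<noteq> \<zero>\<^bsub>R\<^esub>}"

(* The formal sum of the f g * g is encoded by its coefficient function f, which is
   finitely supported on carrier G and undefined outside, so that equality in the
   group ring is equality of functions. *)
definition group_ring :: "('a, 'm) ring_scheme \<Rightarrow> ('g, 'n) monoid_scheme \<Rightarrow> ('g \<Rightarrow> 'a) ring" where
  "group_ring R G =
     \<lparr>carrier = {f \<in> carrier G \<rightarrow>\<^sub>E carrier R. finite (coeff_support R G f)},
      mult = (\<lambda>f h. \<lambda>x\<in>carrier G.
        finsum R (\<lambda>(a, b). f a \<otimes>\<^bsub>R\<^esub> h b)
          {(a, b). a \<in> coeff_support R G f \<and> b \<in> coeff_support R G h \<and> a \<otimes>\<^bsub>G\<^esub> b = x}),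
      one = (\<lambda>x\<in>carrier G. if x = \<one>\<^bsub>G\<^esub> then \<one>\<^bsub>R\<^esub> else \<zero>\<^bsub>R\<^esub>),
      zero = (\<lambda>x\<in>carrier G. \<zero>\<^bsub>R\<^esub>),
      add = (\<lambda>f h. \<lambda>x\<in>carrier G. f x \<oplus>\<^bsub>R\<^esub> h x)\<rparr>"

end

theory Submission
  imports Defs "HOL-Algebra.RingHom" "HOL-Algebra.Group_Action" "HOL-Algebra.Sylow"
begin

text \<open>
  Let \<open>\<Delta>\<close> be the kernel of the augmentation \<open>RG \<rightarrow> R\<close>. An element of \<open>\<Delta>\<close> outside the radical of \<open>RG\<close>
  would be \<open>u + n\<close> with \<open>u\<close> a unit and \<open>n\<close> nilpotent, and applying the augmentation would make a
  unit of \<open>R\<close> nilpotent; so \<open>\<Delta>\<close> lies in the radical. Explicit elements of \<open>\<Delta>\<close> then show that every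
  \<open>g \<noteq> 1\<close> has a finite order lying in the radical of \<open>R\<close>, and two distinct primes cannot both lie
  in the radical.

  Conversely, if \<open>G\<close> is a locally finite \<open>p\<close>-group and \<open>p\<close> is nilpotent in \<open>R\<close>, then \<open>\<Delta>\<close> is nil: a finite
  \<open>p\<close>-group has non-trivial fixed points on every non-trivial finite abelian \<open>p\<close>-group, so long
  products of elements \<open>h - 1\<close> vanish. Given \<open>x\<close> outside the radical of \<open>RG\<close>, its augmentation is
  \<open>u + n\<close>, and \<open>x = u + (x - u)\<close> where \<open>x - u\<close> is nilpotent because its augmentation \<open>n\<close> is and \<open>\<Delta>\<close> is nil.
\<close>

section \<open>The Jacobson radical and fineness\<close>

text \<open>Noncommutativity decides how the radical is handled: \<open>x\<close> lies in it iff
  every 1 - r x has a left inverse, and only such left inverses are ever produced or exploited. In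
  the converse direction the obstacle is that p is merely nilpotent in \<open>R\<close>, and
  \<open>R\<close> is arbitrary, so the group ring is neither finite nor a vector space over a field
  with p elements and fixed points cannot be counted on it. They are counted on something smaller:
  since p^k times 1 vanishes for some k, the additive subgroup generated by a finite p-group inside
  the ring is finite, and so is its quotient by the elements killed by all sufficiently long
  products of factors h - 1. That quotient turns out to be trivial, so 1 itself is killed. Passing
  from products of the h - 1 to combinations of them with coefficients in \<open>R\<close> works
  because coefficients commute with group elements, even when they do not commute with each other.
  Units and torsion units both contain 1 and are preserved by ring homomorphisms; this is all that
  the arguments ask of them, so both notions of fineness are treated at once.\<close>

lemma (in ring) left_idealI:
  assumes "I \<subseteq> carrier R" "\<zero> \<in> I" "\<And>x y. x \<in> I \<Longrightarrow> y \<in> I \<Longrightarrow> x \<oplus> y \<in> I"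
    "\<And>a x. a \<in> I \<Longrightarrow> x \<in> carrier R \<Longrightarrow> x \<otimes> a \<in> I"
  shows "left_ideal I R"
proof (intro left_ideal.intro additive_subgroup.intro left_ideal_axioms.intro)
  show "subgroup I (add_monoid R)"
  proof (rule add.subgroupI)
    fix a assume a: "a \<in> I"
    have "(\<ominus> \<one>) \<otimes> a \<in> I" using a assms(4) by simp
    then show "\<ominus> a \<in> I" using a assms(1) l_minus[of \<one> a] by auto
  qed (use assms in auto)
qed (use assms in \<open>auto intro: ring_axioms\<close>)

lemma (in left_ideal) carrier_if_one:
  assumes "\<one> \<in> I" shows "I = carrier R"
  using I_l_closed[OF assms] a_subset by force

text \<open>Zorn's lemma applies to the left ideals above \<open>I\<close> that omit the identity:
  this property passes to unions of chains, and by \<open>carrier_if_one\<close> it is the same as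
  being proper.\<close>

lemma (in ring) maximal_left_ideal_exists:
  assumes I: "left_ideal I R" and one: "\<one> \<notin> I"
  shows "\<exists>M. maximal_left_ideal M R \<and> I \<subseteq> M"
proof -
  define A where "A = {L. left_ideal L R \<and> \<one> \<notin> L \<and> I \<subseteq> L}"
  have "A \<noteq> {}" using I one by (auto simp: A_def)
  moreover have "\<Union>C \<in> A" if ne: "C \<noteq> {}" and ch: "subset.chain A C" for C
  proof -
    have C: "\<And>L. L \<in> C \<Longrightarrow> left_ideal L R \<and> \<one> \<notin> L \<and> I \<subseteq> L"
      and lin: "\<And>L L'. L \<in> C \<Longrightarrow> L' \<in> C \<Longrightarrow> L \<subseteq> L' \<or> L' \<subseteq> L"
      using ch unfolding subset.chain_def A_def by auto
    have sub: "\<And>L. L \<in> C \<Longrightarrow> additive_subgroup L R"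
      using C left_ideal.axioms(1) by blast
    have "left_ideal (\<Union>C) R"
    proof (rule left_idealI)
      show "\<Union>C \<subseteq> carrier R" using sub additive_subgroup.a_subset by blast
      show "\<zero> \<in> \<Union>C" using ne sub additive_subgroup.zero_closed by blast
    next
      fix x y assume "x \<in> \<Union>C" "y \<in> \<Union>C"
      then obtain L L' where "x \<in> L" "L \<in> C" "y \<in> L'" "L' \<in> C" by blast
      then obtain K where K: "K \<in> C" "x \<in> K" "y \<in> K" using lin by blast
      then have "x \<oplus> y \<in> K" using additive_subgroup.a_closed[OF sub] by simp
      then show "x \<oplus> y \<in> \<Union>C" using K(1) by (rule UnionI[rotated])
    next
      fix a x assume "a \<in> \<Union>C" and x: "x \<in> carrier R"
      then obtain L where L: "a \<in> L" "L \<in> C" by blast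
      then have "x \<otimes> a \<in> L" using left_ideal.I_l_closed[of L R] C x by simp
      then show "x \<otimes> a \<in> \<Union>C" using L(2) by (rule UnionI[rotated])
    qed
    then show ?thesis using C ne unfolding A_def by blast
  qed
  ultimately obtain M where MA: "M \<in> A" and mx': "\<forall>X\<in>A. M \<subseteq> X \<longrightarrow> X = M"
    using subset_Zorn_nonempty[of A] by auto
  have M: "left_ideal M R" "\<one> \<notin> M" "I \<subseteq> M" using MA by (simp_all add: A_def)
  have mx: "X = M" if "left_ideal X R" "\<one> \<notin> X" "I \<subseteq> X" "M \<subseteq> X" for X
    using mx' that by (simp add: A_def)
  have "maximal_left_ideal M R"
  proof (intro maximal_left_ideal.intro maximal_left_ideal_axioms.intro M)
    show "carrier R \<noteq> M" using M by auto
    fix J assume "left_ideal J R" "M \<subseteq> J" "J \<subseteq> carrier R"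
    then show "J = M \<or> J = carrier R"
      using mx[of J] left_ideal.carrier_if_one[of J R] M(3) by auto
  qed
  then show ?thesis using M by blast
qed

text \<open>If 1 - r x had no left inverse, the left ideal it generates would lie in a maximal one,
  which also contains r x and hence 1. Conversely, if a maximal left ideal M omits x, then M + R x
  is everything, so 1 = m + r x with m in M; the left inverse of m = 1 - r x then puts 1 into
  M.\<close>

lemma (in ring) mem_jacobson_radical_iff:
  "x \<in> jacobson_radical R \<longleftrightarrow>
     x \<in> carrier R \<and> (\<forall>r\<in>carrier R. \<exists>y\<in>carrier R. y \<otimes> (\<one> \<ominus> r \<otimes> x) = \<one>)"
proof (intro iffI conjI ballI)
  assume x: "x \<in> jacobson_radical R"
  then show xc: "x \<in> carrier R" by (simp add: jacobson_radical_def)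
  fix r assume r: "r \<in> carrier R"
  let ?I = "(\<lambda>y. y \<otimes> (\<one> \<ominus> r \<otimes> x)) ` carrier R"
  have c: "\<one> \<ominus> r \<otimes> x \<in> carrier R" using xc r by simp
  have "left_ideal ?I R"
  proof (rule left_idealI)
    show "\<zero> \<in> ?I" using c by (auto intro!: image_eqI[of _ _ \<zero>])
  next
    fix u v assume "u \<in> ?I" "v \<in> ?I"
    then obtain a b where "a \<in> carrier R" "b \<in> carrier R"
      "u = a \<otimes> (\<one> \<ominus> r \<otimes> x)" "v = b \<otimes> (\<one> \<ominus> r \<otimes> x)" by auto
    then show "u \<oplus> v \<in> ?I" using c by (auto intro!: image_eqI[of _ _ "a \<oplus> b"] simp: l_distr)
  next
    fix u v assume "u \<in> ?I" "v \<in> carrier R"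
    then obtain a where "a \<in> carrier R" "u = a \<otimes> (\<one> \<ominus> r \<otimes> x)" by auto
    then show "v \<otimes> u \<in> ?I" using c \<open>v \<in> carrier R\<close>
      by (auto intro!: image_eqI[of _ _ "v \<otimes> a"] simp: m_assoc)
  qed (use c in auto)
  moreover have "\<not> (maximal_left_ideal M R \<and> ?I \<subseteq> M)" for M
  proof
    assume M: "maximal_left_ideal M R \<and> ?I \<subseteq> M"
    then interpret M: maximal_left_ideal M R by blast
    have "x \<in> M" using x M by (auto simp: jacobson_radical_def)
    then have "r \<otimes> x \<in> M" using M.I_l_closed r by blast
    moreover have "\<one> \<ominus> r \<otimes> x \<in> M" using M c by (metis image_subset_iff l_one one_closed)
    ultimately have "(\<one> \<ominus> r \<otimes> x) \<oplus> r \<otimes> x \<in> M" by blast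
    then have "\<one> \<in> M" using xc r by (simp add: a_minus_def a_assoc l_neg)
    then show False using M.carrier_if_one M.I_notcarr by blast
  qed
  ultimately have "\<one> \<in> ?I" using maximal_left_ideal_exists by blast
  then show "\<exists>y\<in>carrier R. y \<otimes> (\<one> \<ominus> r \<otimes> x) = \<one>" by force
next
  assume x: "x \<in> carrier R \<and> (\<forall>r\<in>carrier R. \<exists>y\<in>carrier R. y \<otimes> (\<one> \<ominus> r \<otimes> x) = \<one>)"
  have "x \<in> M" if "maximal_left_ideal M R" for M
  proof (rule ccontr)
    assume xM: "x \<notin> M"
    interpret M: maximal_left_ideal M R by fact
    have xc: "x \<in> carrier R" using x by simp
    let ?J = "{m \<oplus> r \<otimes> x | m r. m \<in> M \<and> r \<in> carrier R}"
    have mem: "m \<oplus> r \<otimes> x \<in> ?J" if "m \<in> M" "r \<in> carrier R" for m r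
      using that by blast
    have "left_ideal ?J R"
    proof (rule left_idealI)
      show "?J \<subseteq> carrier R" using xc by auto
      show "\<zero> \<in> ?J" using mem[OF M.zero_closed zero_closed] xc by simp
    next
      fix u v assume "u \<in> ?J" "v \<in> ?J"
      then obtain m r m' r' where *: "m \<in> M" "r \<in> carrier R" "u = m \<oplus> r \<otimes> x"
        "m' \<in> M" "r' \<in> carrier R" "v = m' \<oplus> r' \<otimes> x" by blast
      then have "u \<oplus> v = (m \<oplus> m') \<oplus> (r \<oplus> r') \<otimes> x"
        using xc M.a_Hcarr by (simp add: l_distr a_ac)
      then show "u \<oplus> v \<in> ?J" using mem * by simp
    next
      fix u v assume "u \<in> ?J" and v: "v \<in> carrier R"
      then obtain m r where *: "m \<in> M" "r \<in> carrier R" "u = m \<oplus> r \<otimes> x" by blast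
      then have "v \<otimes> u = v \<otimes> m \<oplus> (v \<otimes> r) \<otimes> x"
        using xc v M.a_Hcarr by (simp add: r_distr m_assoc)
      then show "v \<otimes> u \<in> ?J" using mem * M.I_l_closed v by simp
    qed
    moreover have "M \<subseteq> ?J" using mem[of _ \<zero>] xc M.a_Hcarr by fastforce
    moreover have "x \<in> ?J" using mem[OF M.zero_closed one_closed] xc by simp
    ultimately have "?J = carrier R"
      using M.I_maximal[of ?J] xM xc by (smt (verit, best) left_ideal.axioms(1) additive_subgroup.a_subset)
    then obtain m r where mr: "m \<in> M" "r \<in> carrier R" "\<one> = m \<oplus> r \<otimes> x"
      using one_closed by blast
    have mc: "m \<in> carrier R" using mr(1) by simp
    have m: "m = \<one> \<ominus> r \<otimes> x"
      unfolding mr(3) using mc mr(2) xc by (simp add: a_minus_def a_assoc r_neg)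
    obtain y where "y \<in> carrier R" "y \<otimes> m = \<one>" using x mr(2) m by blast
    then have "\<one> \<in> M" using M.I_l_closed[OF mr(1)] by metis
    then show False using M.carrier_if_one M.I_notcarr by blast
  qed
  then show "x \<in> jacobson_radical R" using x by (auto simp: jacobson_radical_def)
qed

lemma (in ring) jacobson_radical_carrier: "x \<in> jacobson_radical R \<Longrightarrow> x \<in> carrier R"
  by (simp add: jacobson_radical_def)

lemma (in ring) jacobson_radical_left_inverse:
  assumes "x \<in> jacobson_radical R" "r \<in> carrier R"
  obtains y where "y \<in> carrier R" "y \<otimes> (\<one> \<ominus> r \<otimes> x) = \<one>"
  using assms mem_jacobson_radical_iff[of x] by auto

lemma (in ring) jacobson_radicalI:
  assumes "x \<in> carrier R"
    and "\<And>r. r \<in> carrier R \<Longrightarrow> \<exists>y\<in>carrier R. y \<otimes> (\<one> \<ominus> r \<otimes> x) = \<one>"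
  shows "x \<in> jacobson_radical R"
  using assms mem_jacobson_radical_iff[of x] by auto

section \<open>Nilpotent elements, units and the radical\<close>

lemma (in ring) zero_nilpotent: "\<zero> \<in> nilpotents R"
  by (auto simp: nilpotents_def intro!: exI[of _ "1::nat"])

lemma nilpotents_carrier: "x \<in> nilpotents R \<Longrightarrow> x \<in> carrier R"
  by (simp add: nilpotents_def)

text \<open>The product of the k-th powers of \<open>y\<close> and \<open>x\<close> collapses from
  the middle to 1, whether or not \<open>x\<close> and \<open>y\<close> commute; taking k with
  vanishing power of \<open>x\<close> gives 1 = 0.\<close>

lemma (in ring) left_inverse_nilpotent:
  assumes "x \<in> nilpotents R" "y \<in> carrier R" "y \<otimes> x = \<one>"
  shows "\<one> = \<zero>"
proof -
  obtain n :: nat where x: "x \<in> carrier R" and n: "x [^] n = \<zero>"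
    using assms(1) by (auto simp: nilpotents_def)
  have "y [^] k \<otimes> x [^] k = \<one>" for k :: nat
  proof (induction k)
    case (Suc k)
    have "y [^] Suc k \<otimes> x [^] Suc k = y [^] k \<otimes> (y \<otimes> x) \<otimes> x [^] k"
      unfolding nat_pow_Suc[of y] nat_pow_Suc2[OF x] using x assms(2) by (simp add: m_assoc)
    then show ?case using assms x Suc by simp
  qed simp
  from this[of n] show ?thesis using n assms(2) by simp
qed

text \<open>With the multiplier \<open>inv u\<close>, the element 1 - (inv u)(u + n) equals -(inv u)
  n. A left inverse of it would yield a left inverse of the nilpotent \<open>n\<close>.\<close>

lemma (in ring) unit_add_nilpotent_notin_jacobson_radical:
  assumes "\<one> \<noteq> \<zero>" "u \<in> Units R" "n \<in> nilpotents R"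
  shows "u \<oplus> n \<notin> jacobson_radical R"
proof
  assume J: "u \<oplus> n \<in> jacobson_radical R"
  have n: "n \<in> carrier R" and u: "u \<in> carrier R" using assms by (auto simp: nilpotents_def)
  have i: "inv u \<in> carrier R" using assms by simp
  obtain y where y: "y \<in> carrier R" "y \<otimes> (\<one> \<ominus> inv u \<otimes> (u \<oplus> n)) = \<one>"
    using jacobson_radical_left_inverse[OF J i] .
  have "\<one> \<ominus> inv u \<otimes> (u \<oplus> n) = (\<ominus> (inv u)) \<otimes> n"
    using assms(2) n u i by (simp add: r_distr a_minus_def minus_add a_assoc[symmetric] r_neg l_minus)
  then have "(y \<otimes> (\<ominus> (inv u))) \<otimes> n = \<one>" using y n i by (simp add: m_assoc)
  then show False
    using left_inverse_nilpotent[OF assms(3), of "y \<otimes> (\<ominus> (inv u))"] y(1) i assms(1) by simp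
qed

text \<open>Instantiating \<open>T\<close> with the torsion units or with all units gives the two fineness notions.\<close>

definition fine_by :: "'a set \<Rightarrow> ('a, 'm) ring_scheme \<Rightarrow> bool" where
  "fine_by T R \<longleftrightarrow> carrier R - jacobson_radical R = T <+>\<^bsub>R\<^esub> nilpotents R"

text \<open>In a non-zero ring one inclusion is automatic, since a unit plus a nilpotent is never in
  the radical. The zero ring is excluded by fineness itself: its radical is everything, so the
  complement is empty, while the sum set contains 1 + 0.\<close>

lemma (in ring) fine_by_iff:
  assumes "T \<subseteq> Units R" "\<one> \<in> T"
  shows "fine_by T R \<longleftrightarrow> \<one> \<noteq> \<zero> \<and>
    (\<forall>x\<in>carrier R - jacobson_radical R. \<exists>u\<in>T. \<exists>n\<in>nilpotents R. x = u \<oplus> n)"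
proof (cases "\<one> = \<zero>")
  case True
  have zero: "x = \<zero>" if "x \<in> carrier R" for x
    using l_one[OF that] l_null[OF that] True by simp
  have "x \<in> jacobson_radical R" if "x \<in> carrier R" for x
  proof (rule jacobson_radicalI[OF that])
    fix r assume "r \<in> carrier R"
    then have "\<one> \<otimes> (\<one> \<ominus> r \<otimes> x) = \<one>"
      using zero[of "\<one> \<otimes> (\<one> \<ominus> r \<otimes> x)"] that True by simp
    then show "\<exists>y\<in>carrier R. y \<otimes> (\<one> \<ominus> r \<otimes> x) = \<one>" by blast
  qed
  then have "jacobson_radical R = carrier R"
    using jacobson_radical_carrier by blast
  moreover have "\<one> \<oplus> \<zero> \<in> T <+>\<^bsub>R\<^esub> nilpotents R"
    using assms(2) zero_nilpotent unfolding set_add_def' by blast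
  ultimately show ?thesis using True unfolding fine_by_def by auto
next
  case False
  have "T <+>\<^bsub>R\<^esub> nilpotents R \<subseteq> carrier R - jacobson_radical R"
  proof
    fix x assume "x \<in> T <+>\<^bsub>R\<^esub> nilpotents R"
    then obtain u n where "u \<in> T" and n: "n \<in> nilpotents R" and x: "x = u \<oplus> n"
      unfolding set_add_def' by blast
    then have u: "u \<in> Units R" using assms(1) by blast
    show "x \<in> carrier R - jacobson_radical R"
      using unit_add_nilpotent_notin_jacobson_radical[OF False u n] Units_closed[OF u] nilpotents_carrier[OF n] x
      by simp
  qed
  moreover have "x \<in> T <+>\<^bsub>R\<^esub> nilpotents R \<longleftrightarrow> (\<exists>u\<in>T. \<exists>n\<in>nilpotents R. x = u \<oplus> n)" for x
    by (auto simp: set_add_def')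
  ultimately show ?thesis using False unfolding fine_by_def by blast
qed

lemma (in ring) generalized_fine_iff: "generalized_fine R \<longleftrightarrow> fine_by (Units R) R"
  by (simp add: generalized_fine_def fine_by_def)

lemma (in ring) generalized_t_fine_iff: "generalized_t_fine R \<longleftrightarrow> fine_by (torsion_units R) R"
  by (simp add: generalized_t_fine_def fine_by_def)

lemma (in ring) torsion_units_subset: "torsion_units R \<subseteq> Units R" "\<one> \<in> torsion_units R"
  by (auto simp: torsion_units_def intro!: exI[of _ "1::nat"])

section \<open>Transfer along ring homomorphisms\<close>

lemma (in ring_hom_ring) hom_Units:
  assumes "u \<in> Units R" shows "h u \<in> Units S"
proof -
  have u: "u \<in> carrier R" "inv u \<in> carrier R"
    using assms R.Units_closed by simp_all
  have "h u \<otimes>\<^bsub>S\<^esub> h (inv u) = h \<one>" "h (inv u) \<otimes>\<^bsub>S\<^esub> h u = h \<one>"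
    using u assms by (simp_all flip: hom_mult)
  then show ?thesis using u unfolding Units_def by auto
qed

lemma (in ring_hom_ring) hom_torsion_units:
  assumes "u \<in> torsion_units R" shows "h u \<in> torsion_units S"
proof -
  obtain m :: nat where "u \<in> Units R" "m \<ge> 1" "u [^] m = \<one>"
    using assms by (auto simp: torsion_units_def)
  then show ?thesis using hom_Units hom_nat_pow[of u m]
    by (auto simp: torsion_units_def intro!: exI[of _ m] dest: R.Units_closed)
qed

lemma (in ring_hom_ring) hom_nilpotents:
  assumes "x \<in> nilpotents R" shows "h x \<in> nilpotents S"
proof -
  obtain m :: nat where "x \<in> carrier R" "m \<ge> 1" "x [^] m = \<zero>"
    using assms by (auto simp: nilpotents_def)
  then show ?thesis using hom_nat_pow[of x m]
    by (auto simp: nilpotents_def intro!: exI[of _ m])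
qed

text \<open>Surjectivity lets each multiplier \<open>s\<close> be lifted to the source; the image of
  the left inverse found there is the one required.\<close>

lemma (in ring_hom_ring) hom_jacobson_radical:
  assumes surj: "h ` carrier R = carrier S" and x: "x \<in> jacobson_radical R"
  shows "h x \<in> jacobson_radical S"
proof -
  have xc: "x \<in> carrier R" using x by (rule R.jacobson_radical_carrier)
  have "\<exists>y\<in>carrier S. y \<otimes>\<^bsub>S\<^esub> (\<one>\<^bsub>S\<^esub> \<ominus>\<^bsub>S\<^esub> s \<otimes>\<^bsub>S\<^esub> h x) = \<one>\<^bsub>S\<^esub>" if s: "s \<in> carrier S" for s
  proof -
    obtain r where r: "r \<in> carrier R" "s = h r" using s surj by blast
    obtain y where y: "y \<in> carrier R" "y \<otimes> (\<one> \<ominus> r \<otimes> x) = \<one>"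
      using R.jacobson_radical_left_inverse[OF x r(1)] .
    have "h (y \<otimes> (\<one> \<ominus> r \<otimes> x)) = \<one>\<^bsub>S\<^esub>" using y by simp
    then have "h y \<otimes>\<^bsub>S\<^esub> (\<one>\<^bsub>S\<^esub> \<ominus>\<^bsub>S\<^esub> s \<otimes>\<^bsub>S\<^esub> h x) = \<one>\<^bsub>S\<^esub>"
      using y(1) r xc by (simp add: R.minus_eq S.minus_eq)
    then show ?thesis by (rule bexI) (use y(1) in simp)
  qed
  then show ?thesis by (rule S.jacobson_radicalI[OF hom_closed[OF xc]])
qed

lemma (in ring_hom_ring) fine_by_image:
  assumes fine: "fine_by T R" and T: "T \<subseteq> Units R" "\<one> \<in> T"
    and T': "T' \<subseteq> Units S" "h ` T \<subseteq> T'"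
    and surj: "h ` carrier R = carrier S" and "\<one>\<^bsub>S\<^esub> \<noteq> \<zero>\<^bsub>S\<^esub>"
  shows "fine_by T' S"
proof -
  have "\<exists>u\<in>T'. \<exists>n\<in>nilpotents S. x = u \<oplus>\<^bsub>S\<^esub> n"
    if x: "x \<in> carrier S - jacobson_radical S" for x
  proof -
    obtain y where y: "y \<in> carrier R" "x = h y" using x surj by blast
    then have "y \<notin> jacobson_radical R" using x hom_jacobson_radical[OF surj] by blast
    then obtain u n where *: "u \<in> T" "n \<in> nilpotents R" "y = u \<oplus> n"
      using fine y unfolding R.fine_by_iff[OF T] by blast
    have "u \<in> carrier R" using * T R.Units_closed by blast
    then have "x = h u \<oplus>\<^bsub>S\<^esub> h n" using y *(3) nilpotents_carrier[OF *(2)] by simp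
    moreover have "h u \<in> T'" using T' * by blast
    ultimately show ?thesis using hom_nilpotents[OF *(2)] by blast
  qed
  moreover have "\<one>\<^bsub>S\<^esub> \<in> T'" using T T' hom_one by force
  ultimately show ?thesis using assms(7) S.fine_by_iff[OF T'(1)] by simp
qed

lemma (in ring_hom_ring) kernel_subset_jacobson_radical:
  assumes fine: "fine_by T R" and T: "T \<subseteq> Units R" "\<one> \<in> T" and "\<one>\<^bsub>S\<^esub> \<noteq> \<zero>\<^bsub>S\<^esub>"
    and x: "x \<in> carrier R" "h x = \<zero>\<^bsub>S\<^esub>"
  shows "x \<in> jacobson_radical R"
proof (rule ccontr)
  assume "x \<notin> jacobson_radical R"
  then obtain u n where *: "u \<in> T" "n \<in> nilpotents R" "x = u \<oplus> n"
    using fine x(1) unfolding R.fine_by_iff[OF T] by blast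
  have u: "h u \<in> Units S" using T *(1) hom_Units by blast
  have n: "h n \<in> nilpotents S" using *(2) hom_nilpotents by blast
  have "h u \<oplus>\<^bsub>S\<^esub> h n = \<zero>\<^bsub>S\<^esub>"
  proof -
    have "u \<in> carrier R" using * T R.Units_closed by blast
    then show ?thesis using x *(3) nilpotents_carrier[OF *(2)] by simp
  qed
  \<comment> \<open>The contradiction is reached through the radical: it contains 0 but no unit plus
    nilpotent, so \<open>h u\<close> and \<open>h n\<close> cannot cancel.\<close>
  moreover have "\<zero>\<^bsub>S\<^esub> \<in> jacobson_radical S"
    by (rule S.jacobson_radicalI) (auto simp: S.minus_eq intro!: bexI[of _ "\<one>\<^bsub>S\<^esub>"])
  ultimately show False
    using S.unit_add_nilpotent_notin_jacobson_radical[OF assms(4) u n] by simp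
qed

lemma (in ring) nilpotent_pow:
  assumes "x \<in> carrier R" "m \<ge> (1::nat)" "x [^] m \<in> nilpotents R"
  shows "x \<in> nilpotents R"
proof -
  obtain k :: nat where k: "k \<ge> 1" "(x [^] m) [^] k = \<zero>" using assms by (auto simp: nilpotents_def)
  then have "x [^] (m * k) = \<zero>" using assms by (simp add: nat_pow_pow)
  then show ?thesis using assms k unfolding nilpotents_def
    by (auto intro!: exI[of _ "m * k"])
qed

text \<open>The inverse is the finite geometric series: the induction builds y = 1 + d + ... +
  d^(k-1), starting from the empty sum, with y (1 - d) = 1 - d^k.\<close>

lemma (in ring) one_minus_nilpotent_left_inverse:
  assumes d: "d \<in> nilpotents R"
  shows "\<exists>y\<in>carrier R. y \<otimes> (\<one> \<ominus> d) = \<one>"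
proof -
  obtain n :: nat where dc: "d \<in> carrier R" and n: "d [^] n = \<zero>"
    using d by (auto simp: nilpotents_def)
  have "\<exists>y\<in>carrier R. y \<otimes> (\<one> \<ominus> d) = \<one> \<ominus> d [^] k" for k :: nat
  proof (induction k)
    case 0
    show ?case using dc by (intro bexI[of _ \<zero>]) (auto simp: r_neg minus_eq)
  next
    case (Suc k)
    then obtain y where y: "y \<in> carrier R" "y \<otimes> (\<one> \<ominus> d) = \<one> \<ominus> d [^] k" by blast
    have "(y \<oplus> d [^] k) \<otimes> (\<one> \<ominus> d) = (\<one> \<ominus> d [^] k) \<oplus> (d [^] k \<ominus> d [^] k \<otimes> d)"
      using y dc by (simp add: l_distr) (simp add: r_distr minus_eq r_minus)
    also have "\<dots> = \<one> \<ominus> d [^] Suc k"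
      using dc by (simp add: minus_eq a_assoc) (simp add: a_assoc[symmetric] l_neg)
    finally show ?case using y dc by blast
  qed
  from this[of n] show ?thesis using n by (simp add: minus_eq)
qed

text \<open>Here \<open>h\<close> is a retraction with section \<open>i\<close> and nil kernel.
  Besides the decomposition of \<open>x\<close>, one must know that \<open>h x\<close> stays outside
  the radical of \<open>S\<close>; this holds because one-sided invertibility lifts modulo a nil
  kernel.\<close>

lemma (in ring_hom_ring) fine_by_lift:
  assumes fine: "fine_by T' S" and T': "T' \<subseteq> Units S" "\<one>\<^bsub>S\<^esub> \<in> T'"
    and T: "T \<subseteq> Units R" "\<one> \<in> T"
    and i: "ring_hom_ring S R i" "i ` T' \<subseteq> T" "\<And>s. s \<in> carrier S \<Longrightarrow> h (i s) = s"
    and nil: "\<And>x. x \<in> carrier R \<Longrightarrow> h x = \<zero>\<^bsub>S\<^esub> \<Longrightarrow> x \<in> nilpotents R"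
  shows "fine_by T R"
proof -
  interpret i: ring_hom_ring S R i by fact
  \<comment> \<open>If a power of \<open>h x\<close> vanishes, the same power of \<open>x\<close>
    lies in the kernel and is nilpotent.\<close>
  have nil': "x \<in> nilpotents R" if x: "x \<in> carrier R" "h x \<in> nilpotents S" for x
  proof -
    obtain m :: nat where m: "m \<ge> 1" "h x [^]\<^bsub>S\<^esub> m = \<zero>\<^bsub>S\<^esub>" using x(2) by (auto simp: nilpotents_def)
    then have "x [^] m \<in> nilpotents R" using x(1) by (intro nil) (simp_all add: hom_nat_pow)
    then show ?thesis by (rule R.nilpotent_pow[OF x(1) m(1)])
  qed
  have ne: "\<one>\<^bsub>S\<^esub> \<noteq> \<zero>\<^bsub>S\<^esub>" using fine S.fine_by_iff[OF T'] by blast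
  then have "\<one> \<noteq> \<zero>" using hom_one hom_zero by fastforce
  moreover have "\<exists>u\<in>T. \<exists>n\<in>nilpotents R. x = u \<oplus> n"
    if x: "x \<in> carrier R - jacobson_radical R" for x
  proof -
    have xc: "x \<in> carrier R" using x by simp
    have "h x \<notin> jacobson_radical S"
    proof
      assume J: "h x \<in> jacobson_radical S"
      have "\<exists>y\<in>carrier R. y \<otimes> (\<one> \<ominus> r \<otimes> x) = \<one>" if r: "r \<in> carrier R" for r
      proof -
        obtain c where c: "c \<in> carrier S" "c \<otimes>\<^bsub>S\<^esub> (\<one>\<^bsub>S\<^esub> \<ominus>\<^bsub>S\<^esub> h r \<otimes>\<^bsub>S\<^esub> h x) = \<one>\<^bsub>S\<^esub>"
          using S.jacobson_radical_left_inverse[OF J hom_closed[OF r]] .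
        \<comment> \<open>\<open>z\<close> maps to 1, so 1 - z lies in the nil kernel and z = 1 - (1
          - z) has a left inverse \<open>y\<close>; then y times \<open>i c\<close> is a left
          inverse of 1 - r x.\<close>
        define z where "z = i c \<otimes> (\<one> \<ominus> r \<otimes> x)"
        have zc: "z \<in> carrier R" using c xc r by (simp add: z_def)
        have "h z = \<one>\<^bsub>S\<^esub>" using c xc r i(3) by (simp add: z_def R.minus_eq S.minus_eq)
        then have "\<one> \<ominus> z \<in> nilpotents R"
          using zc by (intro nil) (simp_all add: R.minus_eq S.r_neg)
        then obtain y where y: "y \<in> carrier R" "y \<otimes> (\<one> \<ominus> (\<one> \<ominus> z)) = \<one>"
          using R.one_minus_nilpotent_left_inverse[of "\<one> \<ominus> z"] by auto
        have "\<one> \<ominus> (\<one> \<ominus> z) = z"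
          using zc by (simp add: R.minus_eq R.minus_add R.a_assoc[symmetric] R.r_neg)
        then have "(y \<otimes> i c) \<otimes> (\<one> \<ominus> r \<otimes> x) = \<one>"
          using y c r xc by (simp add: z_def R.m_assoc)
        then show ?thesis by (rule bexI) (use y(1) c(1) in simp)
      qed
      then have "x \<in> jacobson_radical R" by (rule R.jacobson_radicalI[OF xc])
      then show False using x by blast
    qed
    then have "h x \<in> carrier S - jacobson_radical S" using xc by simp
    then obtain u n where un: "u \<in> T'" "n \<in> nilpotents S" "h x = u \<oplus>\<^bsub>S\<^esub> n"
      using fine unfolding S.fine_by_iff[OF T'] by blast
    have uc: "u \<in> carrier S" using un(1) T'(1) S.Units_closed by auto
    have nc: "n \<in> carrier S" using un(2) by (rule nilpotents_carrier)
    have "h (x \<ominus> i u) = u \<oplus>\<^bsub>S\<^esub> n \<oplus>\<^bsub>S\<^esub> \<ominus>\<^bsub>S\<^esub> u"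
      using uc un(3) xc i(3) by (simp add: R.minus_eq)
    also have "\<dots> = n"
      using uc nc by (simp add: S.a_comm[of u n] S.a_assoc S.r_neg)
    finally have "h (x \<ominus> i u) = n" .
    then have "x \<ominus> i u \<in> nilpotents R" using nil'[of "x \<ominus> i u"] un xc uc by simp
    moreover have "x = i u \<oplus> (x \<ominus> i u)"
      using xc uc by (simp add: R.minus_eq R.a_lcomm R.r_neg)
    moreover have "i u \<in> T" using un(1) i(2) by auto
    ultimately show ?thesis by (intro bexI)
  qed
  ultimately show ?thesis using R.fine_by_iff[OF T] by simp
qed

section \<open>Finite p-groups inside a ring where p is nilpotent\<close>

lemma prime_power_if_unique_prime:
  fixes n p :: nat
  assumes "n \<noteq> 0" "Factorial_Ring.prime p" "\<And>q. Factorial_Ring.prime q \<Longrightarrow> q dvd n \<Longrightarrow> q = p"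
  shows "\<exists>k. n = p ^ k"
proof -
  have "\<not> is_unit p" using assms(2) not_prime_unit by blast
  then obtain m where m: "n = p ^ multiplicity p n * m" "\<not> p dvd m"
    using multiplicity_decompose'[of n p] assms(1) by metis
  have "m = 1"
  proof (rule ccontr)
    assume "m \<noteq> 1"
    then obtain q where q: "Factorial_Ring.prime q" "q dvd m" using prime_factor_nat by blast
    then have "q dvd n" using m(1) by (metis dvd_mult)
    then show False using assms(3) q m(2) by blast
  qed
  then show ?thesis using m(1) by auto
qed

text \<open>Sylow's theorem with exponent 1 serves as Cauchy's theorem: a prime \<open>q\<close>
  dividing the group order is the order of a subgroup, hence of some element, hence a power of
  \<open>p\<close>.\<close>

lemma finite_p_group_order:
  fixes G (structure)
  assumes "group G" and fin: "finite (carrier G)" and p: "Factorial_Ring.prime p" and pG: "p_group p G"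
  shows "\<exists>n. order G = p ^ n"
proof (rule prime_power_if_unique_prime[OF _ p])
  interpret group G by fact
  show "order G \<noteq> 0" using fin order_gt_0_iff_finite by simp
  fix q assume q: "Factorial_Ring.prime q" "q dvd order G"
  then obtain m where "order G = q ^ 1 * m" by (auto elim: dvdE)
  then obtain H where H: "subgroup H G" "card H = q ^ 1"
    using sylow_thm[OF q(1) is_group _ fin] by blast
  interpret H: subgroup H G by (rule H(1))
  have "card H > 1" using H(2) q(1) prime_gt_1_nat by simp
  then have "H \<noteq> {\<one>}" by auto
  then obtain h where h: "h \<in> H" "h \<noteq> \<one>" using H.one_closed by blast
  have hc: "h \<in> carrier G" using h H.subset by blast
  interpret GH: group "G\<lparr>carrier := H\<rparr>" using H.subgroup_is_group[OF is_group] .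
  have "h [^]\<^bsub>G\<lparr>carrier := H\<rparr>\<^esub> order (G\<lparr>carrier := H\<rparr>) = \<one>"
    using GH.pow_order_eq_1[of h] h(1) by simp
  then have "h [^] q = \<one>" using H(2) by (simp add: order_def flip: nat_pow_consistent)
  then have "ord h dvd q" using hc pow_eq_id by simp
  then have "ord h = q" using q(1) ord_eq_1[OF hc] h(2) by (auto simp: prime_nat_iff)
  then obtain k where "q = p ^ k" using pG hc unfolding p_group_def by metis
  then show "q = p" using q(1) p by (metis prime_power_eq_one_iff prime_dvd_power primes_dvd_imp_eq dvd_refl)
qed

text \<open>Orbit counting: every orbit has size a power of \<open>p\<close>. If \<open>x\<close>
  were the only fixed point, all orbits other than the singleton of \<open>x\<close> would have size
  divisible by \<open>p\<close>, so card E - 1 would be divisible by \<open>p\<close> along with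
  card E.\<close>

lemma p_group_fixed_point:
  fixes H (structure)
  assumes "group H" and ord: "order H = p ^ n" and p: "Factorial_Ring.prime p"
    and E: "finite E" "p dvd card E"
    and closed: "\<And>h x. h \<in> carrier H \<Longrightarrow> x \<in> E \<Longrightarrow> act h x \<in> E"
    and one: "\<And>x. x \<in> E \<Longrightarrow> act \<one> x = x"
    and mult: "\<And>h k x. h \<in> carrier H \<Longrightarrow> k \<in> carrier H \<Longrightarrow> x \<in> E \<Longrightarrow> act (h \<otimes> k) x = act h (act k x)"
    and x: "x \<in> E" "\<And>h. h \<in> carrier H \<Longrightarrow> act h x = x"
  shows "\<exists>y\<in>E. y \<noteq> x \<and> (\<forall>h\<in>carrier H. act h y = y)"
proof (rule ccontr)
  assume contra: "\<not> ?thesis"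
  interpret group H by fact
  \<comment> \<open>The orbit theorems speak of homomorphisms into the group of permutations of
    \<open>E\<close>, whose elements are undefined outside \<open>E\<close>; hence the restriction
    of \<open>act\<close>.\<close>
  define \<phi> where "\<phi> = (\<lambda>h. \<lambda>x\<in>E. act h x)"
  have bij: "\<phi> h \<in> Bij E" if h: "h \<in> carrier H" for h
  proof -
    have "bij_betw (act h) E E"
    proof (rule bij_betw_byWitness[of _ "act (inv h)"])
      show "\<forall>a\<in>E. act (inv h) (act h a) = a" "\<forall>a\<in>E. act h (act (inv h) a) = a"
        using h mult[of "inv h" h] mult[of h "inv h"] one by auto
    qed (use closed h in auto)
    then show ?thesis unfolding \<phi>_def Bij_def by (auto cong: bij_betw_cong)
  qed
  interpret act: group_action H E \<phi>
  proof (intro group_action.intro group_hom.intro group_hom_axioms.intro homI)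
    show "group (BijGroup E)" by (rule group_BijGroup)
    show "\<phi> h \<in> carrier (BijGroup E)" if "h \<in> carrier H" for h
      using bij[OF that] by (simp add: BijGroup_def)
    show "\<phi> (h \<otimes> k) = \<phi> h \<otimes>\<^bsub>BijGroup E\<^esub> \<phi> k" if "h \<in> carrier H" "k \<in> carrier H" for h k
      using that bij closed mult by (auto simp: BijGroup_def \<phi>_def compose_def restrict_def fun_eq_iff)
  qed (rule is_group)
  have fin: "finite (carrier H)"
    using ord p order_gt_0_iff_finite prime_gt_0_nat by simp
  have orb: "orbit H \<phi> y = (\<lambda>h. act h y) ` carrier H" if "y \<in> E" for y
    using that by (auto simp: orbit_def \<phi>_def)
  have "orbit H \<phi> x = {x}" using x(2) one_closed by (auto simp: orb[OF x(1)])
  then have xo: "{x} \<in> orbits H E \<phi>" using x(1) unfolding orbits_def by auto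
  have finO: "finite (orbits H E \<phi>)" using E(1) unfolding orbits_def by simp
  have "p dvd card C" if C: "C \<in> orbits H E \<phi> - {{x}}" for C
  proof -
    obtain y where y: "y \<in> E" "C = orbit H \<phi> y" using C unfolding orbits_def by auto
    have "card C * card (stabilizer H \<phi> y) = p ^ n"
      using act.orbit_stabilizer_theorem[OF y(1)] y(2) ord by (simp add: order_def)
    then have "card C dvd p ^ n" by (metis dvd_triv_left)
    then obtain j where j: "card C = p ^ j" using p divides_primepow_nat by blast
    have "j \<noteq> 0"
    proof
      assume "j = 0"
      then obtain z where z: "C = {z}" using j card_1_singletonE by auto
      moreover have "y \<in> C" using act.orbit_refl[OF y(1)] y(2) by simp
      ultimately have Cy: "C = {y}" by simp
      have "act h y = y" if "h \<in> carrier H" for h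
        using Cy y(2) orb[OF y(1)] that by auto
      then have "y = x" using contra y(1) by blast
      then show False using C Cy by simp
    qed
    then show ?thesis using j by simp
  qed
  then have "p dvd (\<Sum>C\<in>orbits H E \<phi> - {{x}}. card C)" by (rule dvd_sum)
  moreover have "card E = card {x} + (\<Sum>C\<in>orbits H E \<phi> - {{x}}. card C)"
    using act.disjoint_sum[OF E(1), of "\<lambda>_. 1::nat"] sum.remove[OF finO xo, of card] by simp
  ultimately have "p dvd card {x}" using E(2) by (metis dvd_add_left_iff)
  then show False using p by simp
qed

text \<open>Level n is the set of elements killed by left multiplication with every product of n
  factors of the form \<open>f h\<close> minus 1. Thus 1 lies in level n exactly when all such
  products vanish.\<close>

primrec augmentation_annihilator ::
  "('a, 'm) ring_scheme \<Rightarrow> ('h, 'k) monoid_scheme \<Rightarrow> ('h \<Rightarrow> 'a) \<Rightarrow> nat \<Rightarrow> 'a set" where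
  "augmentation_annihilator R H f 0 = {\<zero>\<^bsub>R\<^esub>}"
| "augmentation_annihilator R H f (Suc n) = {v \<in> carrier R.
     \<forall>h\<in>carrier H. (f h \<ominus>\<^bsub>R\<^esub> \<one>\<^bsub>R\<^esub>) \<otimes>\<^bsub>R\<^esub> v \<in> augmentation_annihilator R H f n}"

text \<open>The intended instance has the group ring as \<open>R\<close>, the subgroup generated by
  the support of one element as \<open>H\<close>, and the embedding of group elements as
  \<open>f\<close>. Working with an abstract ring keeps the counting argument free of coefficient
  functions.\<close>

locale finite_p_group_in_ring = ring R + H: group H for R (structure) and H :: "('h, 'k) monoid_scheme" +
  fixes f :: "'h \<Rightarrow> 'a" and p k :: nat
  assumes prime: "Factorial_Ring.prime p" and finite_H: "finite (carrier H)" and p_group: "p_group p H"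
    and char: "[(p ^ k)] \<cdot> \<one> = \<zero>"
    and f_closed [simp]: "\<And>h. h \<in> carrier H \<Longrightarrow> f h \<in> carrier R"
    and f_one [simp]: "f \<one>\<^bsub>H\<^esub> = \<one>"
    and f_mult: "\<And>g h. g \<in> carrier H \<Longrightarrow> h \<in> carrier H \<Longrightarrow> f (g \<otimes>\<^bsub>H\<^esub> h) = f g \<otimes> f h"
begin

abbreviation ann where "ann \<equiv> augmentation_annihilator R H f"

lemma ann_carrier: "v \<in> ann n \<Longrightarrow> v \<in> carrier R"
  by (cases n) auto

lemma ann_zero: "\<zero> \<in> ann n"
  by (induction n) auto

lemma ann_add: "v \<in> ann n \<Longrightarrow> w \<in> ann n \<Longrightarrow> v \<oplus> w \<in> ann n"
  by (induction n arbitrary: v w) (auto simp: r_distr)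

lemma ann_neg: "v \<in> ann n \<Longrightarrow> \<ominus> v \<in> ann n"
  by (induction n arbitrary: v) (auto simp: r_minus)

lemma ann_Suc: "v \<in> ann n \<Longrightarrow> v \<in> ann (Suc n)"
proof (induction n arbitrary: v)
  case (Suc n)
  have v: "v \<in> carrier R" "\<And>h. h \<in> carrier H \<Longrightarrow> (f h \<ominus> \<one>) \<otimes> v \<in> ann n"
    using Suc.prems by auto
  show ?case unfolding augmentation_annihilator.simps(2)[of R H f "Suc n"]
    using v Suc.IH by blast
qed auto

lemma ann_mono: "m \<le> n \<Longrightarrow> v \<in> ann m \<Longrightarrow> v \<in> ann n"
  by (induction rule: dec_induct) (auto simp del: augmentation_annihilator.simps intro: ann_Suc)

text \<open>Write (f h) v as (f h - 1) v + v; both summands lie in level \<open>n\<close> because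
  the levels increase.\<close>

lemma ann_stable: assumes "h \<in> carrier H" "v \<in> ann n" shows "f h \<otimes> v \<in> ann n"
proof -
  have v: "v \<in> carrier R" using assms(2) by (rule ann_carrier)
  have "(f h \<ominus> \<one>) \<otimes> v \<in> ann n" using ann_Suc[OF assms(2)] assms(1) by simp
  then have "(f h \<ominus> \<one>) \<otimes> v \<oplus> v \<in> ann n" using assms(2) by (rule ann_add)
  moreover have "(f h \<ominus> \<one>) \<otimes> v \<oplus> v = f h \<otimes> v"
    using assms(1) v by (simp add: minus_eq l_distr l_minus a_assoc l_neg)
  ultimately show ?thesis by simp
qed

text \<open>The span is taken with integer coefficients, not with coefficients in \<open>R\<close>:
  this is what makes it finite, while it still contains 1 as the image of the identity.\<close>

definition gspan where "gspan = generate (add_monoid R) (f ` carrier H)"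

lemma gspan_subgroup: "subgroup gspan (add_monoid R)"
  unfolding gspan_def by (rule add.generate_is_subgroup) auto

lemma gspan_closed: "v \<in> gspan \<Longrightarrow> v \<in> carrier R"
  using subgroup.subset[OF gspan_subgroup] by auto

lemma gspan_stable: "v \<in> gspan \<Longrightarrow> h \<in> carrier H \<Longrightarrow> f h \<otimes> v \<in> gspan"
  unfolding gspan_def
proof (induction rule: generate.induct)
  case one
  show ?case using one generate.one[of "add_monoid R"] by simp
next
  case (incl g)
  then obtain x where x: "x \<in> carrier H" "g = f x" by blast
  then have "f h \<otimes> g = f (h \<otimes>\<^bsub>H\<^esub> x)" using incl f_mult by simp
  moreover have "h \<otimes>\<^bsub>H\<^esub> x \<in> carrier H" using x incl by simp
  ultimately show ?case by (auto intro!: generate.incl)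
next
  case (inv g)
  then obtain x where x: "x \<in> carrier H" "g = f x" by blast
  then have "f h \<otimes> g = f (h \<otimes>\<^bsub>H\<^esub> x)" using inv f_mult by simp
  moreover have "h \<otimes>\<^bsub>H\<^esub> x \<in> carrier H" using x inv by simp
  ultimately have "inv\<^bsub>add_monoid R\<^esub> (f h \<otimes> g) \<in> generate (add_monoid R) (f ` carrier H)"
    by (intro generate.inv) simp
  then show ?case using x inv by (simp add: r_minus flip: a_inv_def)
next
  case (eng a b)
  have "a \<in> carrier R" "b \<in> carrier R" using eng(1,2) gspan_closed by (simp_all add: gspan_def)
  then show ?case
    using generate.eng[OF eng.IH(1)[OF eng.prems] eng.IH(2)[OF eng.prems]] eng.prems by (simp add: r_distr)
qed

lemma char_mult: assumes "v \<in> carrier R" shows "[(p ^ k)] \<cdot> v = \<zero>"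
  using add_pow_ldistr[of \<one> v "p ^ k"] assms char by simp

text \<open>Natural numbers suffice as coefficients because p^k - 1 acts as -1.\<close>

lemma gspan_combination:
  assumes "v \<in> gspan"
  shows "\<exists>c :: 'h \<Rightarrow> nat. v = (\<Oplus>h\<in>carrier H. [c h] \<cdot> f h)"
  using assms unfolding gspan_def
proof (induction rule: generate.induct)
  case one
  have "(\<Oplus>h\<in>carrier H. [(0::nat)] \<cdot> f h) = \<zero>"
    by (rule add.finprod_one_eqI) simp
  then show ?case by (intro exI[of _ "\<lambda>_. 0"]) simp
next
  case (incl g)
  then obtain x where x: "x \<in> carrier H" "g = f x" by blast
  have "(\<Oplus>h\<in>carrier H. [(if h = x then 1 else 0 :: nat)] \<cdot> f h)
      = (\<Oplus>h\<in>carrier H. if x = h then f h else \<zero>)"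
    by (rule add.finprod_cong') auto
  also have "\<dots> = g" using add.finprod_singleton[of x "carrier H" f] x finite_H by simp
  finally show ?case by (intro exI[of _ "\<lambda>h. if h = x then 1 else 0"]) simp
next
  case (inv g)
  then obtain x where x: "x \<in> carrier H" "g = f x" by blast
  \<comment> \<open>The coefficient p^k - 1 represents the negative of \<open>g\<close>, since
    adding one more copy of \<open>g\<close> gives p^k times \<open>g\<close>, which is 0.\<close>
  have "(\<Oplus>h\<in>carrier H. [(if h = x then p ^ k - 1 else 0 :: nat)] \<cdot> f h)
      = (\<Oplus>h\<in>carrier H. if x = h then [(p ^ k - 1)] \<cdot> f h else \<zero>)"
    by (rule add.finprod_cong') auto
  also have "\<dots> = [(p ^ k - 1)] \<cdot> g"
    using add.finprod_singleton[of x "carrier H" "\<lambda>h. [(p ^ k - 1)] \<cdot> f h"] x finite_H by simp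
  also have "\<dots> = \<ominus> g"
  proof -
    have "p ^ k - 1 + 1 = p ^ k" using prime prime_gt_0_nat[of p] by simp
    then have "[(p ^ k - 1)] \<cdot> g \<oplus> g = \<zero>"
      using add.nat_pow_mult[of g "p ^ k - 1" 1] char_mult[of g] x by simp
    then show ?thesis using minus_equality[of _ g] x by simp
  qed
  finally show ?case
    by (intro exI[of _ "\<lambda>h. if h = x then p ^ k - 1 else 0"]) (simp flip: a_inv_def)
next
  case (eng a b)
  obtain c where c: "a = (\<Oplus>h\<in>carrier H. [(c h :: nat)] \<cdot> f h)" using eng.IH(1) ..
  obtain d where d: "b = (\<Oplus>h\<in>carrier H. [(d h :: nat)] \<cdot> f h)" using eng.IH(2) ..
  have "(\<Oplus>h\<in>carrier H. [(c h + d h)] \<cdot> f h) = (\<Oplus>h\<in>carrier H. [(c h)] \<cdot> f h \<oplus> [(d h)] \<cdot> f h)"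
    by (rule add.finprod_cong') (auto simp: add.nat_pow_mult)
  also have "\<dots> = a \<oplus> b" unfolding c d by (rule add.finprod_multf) auto
  finally show ?case by (intro exI[of _ "\<lambda>h. c h + d h"]) simp
qed

text \<open>Coefficients matter only modulo p^k, so the span is the image of the finite set of
  functions from \<open>H\<close> to the residues below p^k.\<close>

lemma finite_gspan: "finite gspan"
proof (rule finite_subset)
  let ?F = "carrier H \<rightarrow>\<^sub>E {..<p ^ k}"
  show "finite ((\<lambda>c. \<Oplus>h\<in>carrier H. [(c h :: nat)] \<cdot> f h) ` ?F)"
    using finite_H by (intro finite_imageI finite_PiE) auto
  show "gspan \<subseteq> (\<lambda>c. \<Oplus>h\<in>carrier H. [(c h :: nat)] \<cdot> f h) ` ?F"
  proof
    fix v assume "v \<in> gspan"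
    then obtain c where v: "v = (\<Oplus>h\<in>carrier H. [(c h :: nat)] \<cdot> f h)" using gspan_combination by blast
    define c' where "c' = (\<lambda>h\<in>carrier H. c h mod p ^ k)"
    have red: "[(n mod p ^ k)] \<cdot> x = [n] \<cdot> x" if x: "x \<in> carrier R" for n x
    proof -
      have "[n] \<cdot> x = [(p ^ k * (n div p ^ k) + n mod p ^ k)] \<cdot> x" by simp
      also have "\<dots> = [(p ^ k * (n div p ^ k))] \<cdot> x \<oplus> [(n mod p ^ k)] \<cdot> x"
        using add.nat_pow_mult[OF x] by simp
      also have "[(p ^ k * (n div p ^ k))] \<cdot> x = \<zero>"
        using add.nat_pow_pow[OF x, of "n div p ^ k" "p ^ k"] char_mult[OF x] by simp
      finally show ?thesis using x by simp
    qed
    have "v = (\<Oplus>h\<in>carrier H. [(c' h)] \<cdot> f h)"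
      unfolding v by (rule add.finprod_cong') (auto simp: c'_def red)
    moreover have "c' \<in> ?F" using prime prime_gt_0_nat[of p] by (auto simp: c'_def)
    ultimately show "v \<in> (\<lambda>c. \<Oplus>h\<in>carrier H. [(c h :: nat)] \<cdot> f h) ` ?F" by (rule image_eqI)
  qed
qed

text \<open>The part of the span killed by all sufficiently long products. It is a subgroup because
  the levels form an increasing chain; the goal is to show that it is the whole span.\<close>

definition nil_span where "nil_span = gspan \<inter> (\<Union>n. ann n)"

lemma nil_span_D: "w \<in> nil_span \<Longrightarrow> w \<in> gspan" "w \<in> nil_span \<Longrightarrow> w \<in> carrier R"
  using gspan_closed by (auto simp: nil_span_def)

lemma nil_span_subgroup: "subgroup nil_span (add_monoid R)"
proof (rule add.subgroupI)
  show "nil_span \<subseteq> carrier R" using nil_span_D by auto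
  have "\<zero> \<in> nil_span" using subgroup.one_closed[OF gspan_subgroup] ann_zero by (auto simp: nil_span_def)
  then show "nil_span \<noteq> {}" by auto
next
  fix a assume a: "a \<in> nil_span"
  then obtain n where n: "a \<in> gspan" "a \<in> ann n" by (auto simp: nil_span_def)
  then have "\<ominus> a \<in> gspan" using subgroup.m_inv_closed[OF gspan_subgroup] by (simp flip: a_inv_def)
  then show "\<ominus> a \<in> nil_span" using ann_neg[OF n(2)] by (auto simp: nil_span_def)
next
  fix a b assume "a \<in> nil_span" "b \<in> nil_span"
  then obtain m n where mn: "a \<in> gspan" "a \<in> ann m" "b \<in> gspan" "b \<in> ann n" by (auto simp: nil_span_def)
  then have "a \<oplus> b \<in> gspan" using subgroup.m_closed[OF gspan_subgroup] by simp
  moreover have "a \<oplus> b \<in> ann (max m n)"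
    using mn ann_mono[of m "max m n"] ann_mono[of n "max m n"] by (intro ann_add) simp_all
  ultimately show "a \<oplus> b \<in> nil_span" by (auto simp: nil_span_def)
qed

lemma nil_span_stable: "h \<in> carrier H \<Longrightarrow> w \<in> nil_span \<Longrightarrow> f h \<otimes> w \<in> nil_span"
  unfolding nil_span_def using gspan_stable ann_stable by blast

text \<open>Each \<open>h\<close> has its own level \<open>N h\<close>. As \<open>H\<close> is
  finite, these are bounded by a common \<open>M\<close>, and then \<open>v\<close> lies in level M
  + 1.\<close>

lemma nil_span_step:
  assumes v: "v \<in> gspan" and step: "\<And>h. h \<in> carrier H \<Longrightarrow> (f h \<ominus> \<one>) \<otimes> v \<in> nil_span"
  shows "v \<in> nil_span"
proof -
  have "\<forall>h\<in>carrier H. \<exists>n. (f h \<ominus> \<one>) \<otimes> v \<in> ann n" using step by (auto simp: nil_span_def)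
  then obtain N where N: "\<And>h. h \<in> carrier H \<Longrightarrow> (f h \<ominus> \<one>) \<otimes> v \<in> ann (N h)"
    using bchoice[of "carrier H" "\<lambda>h n. (f h \<ominus> \<one>) \<otimes> v \<in> ann n"] by auto
  define M where "M = Max (N ` carrier H)"
  have "(f h \<ominus> \<one>) \<otimes> v \<in> ann M" if "h \<in> carrier H" for h
    using ann_mono[OF _ N[OF that]] finite_H that by (simp add: M_def)
  then have "v \<in> ann (Suc M)" using gspan_closed[OF v] by simp
  then show ?thesis using v by (auto simp: nil_span_def simp del: augmentation_annihilator.simps)
qed

text \<open>If \<open>nil_span \<noteq> gspan\<close>, then the \<open>p\<close>-group \<open>H\<close> fixes a non-trivial coset of
  \<open>nil_span\<close> in \<open>gspan\<close>, contradicting the closure property \<open>nil_span_step\<close>.\<close>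

lemma nil_span_eq_gspan: "nil_span = gspan"
proof (rule ccontr)
  assume "nil_span \<noteq> gspan"
  then obtain u where u: "u \<in> gspan" "u \<notin> nil_span" using nil_span_D(1) by blast
  define A where "A = (add_monoid R)\<lparr>carrier := gspan\<rparr>"
  have A_simps: "carrier A = gspan" "mult A = add R" "one A = \<zero>" by (simp_all add: A_def)
  interpret A: comm_group A
  proof (rule group.group_comm_groupI)
    show "group A" unfolding A_def using add.subgroup_imp_group[OF gspan_subgroup] .
  qed (use gspan_closed a_comm in \<open>simp add: A_simps\<close>)
  have sub: "subgroup nil_span A"
    unfolding A_def using add.subgroup_incl[OF nil_span_subgroup gspan_subgroup] nil_span_D(1) by auto
  interpret nil_span: normal nil_span A using A.subgroup_imp_normal[OF sub] .
  interpret Q: group "A Mod nil_span" by (rule nil_span.factorgroup_is_group)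
  define E where "E = carrier (A Mod nil_span)"
  have E: "E = (\<lambda>v. nil_span #>\<^bsub>A\<^esub> v) ` gspan" by (auto simp: E_def carrier_FactGroup A_simps)
  have coset: "nil_span #>\<^bsub>A\<^esub> v = (\<lambda>w. w \<oplus> v) ` nil_span" for v by (auto simp: r_coset_def A_simps)
  have finE: "finite E" using E finite_gspan by simp
  have u_coset: "nil_span #>\<^bsub>A\<^esub> u \<in> E" "nil_span #>\<^bsub>A\<^esub> u \<noteq> nil_span"
    using u E A.coset_join1[OF _ _ sub, of u] A_simps(1) by auto
  have pow: "(nil_span #>\<^bsub>A\<^esub> u) [^]\<^bsub>A Mod nil_span\<^esub> (p ^ k) = nil_span"
  proof -
    interpret hom: group_hom A "A Mod nil_span" "\<lambda>v. nil_span #>\<^bsub>A\<^esub> v"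
      by (intro group_hom.intro group_hom_axioms.intro A.is_group Q.is_group nil_span.r_coset_hom_Mod)
    have "u [^]\<^bsub>A\<^esub> n = [n] \<cdot> u" for n :: nat
      by (induction n) (simp_all add: A_simps)
    then have "u [^]\<^bsub>A\<^esub> (p ^ k) = \<one>\<^bsub>A\<^esub>" using char_mult[OF gspan_closed[OF u(1)]] A_simps by simp
    then show ?thesis using hom.hom_nat_pow[of u "p ^ k"] u(1) A_simps(1) hom.hom_one by simp
  qed
  \<comment> \<open>The coset of \<open>u\<close> is non-trivial and its order divides p^k, so that
    order is a positive power of \<open>p\<close>; it divides the order of the quotient.\<close>
  have "p dvd card E"
  proof -
    have uE: "nil_span #>\<^bsub>A\<^esub> u \<in> carrier (A Mod nil_span)" using u_coset(1) by (simp add: E_def)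
    have "Q.ord (nil_span #>\<^bsub>A\<^esub> u) dvd p ^ k" using pow Q.pow_eq_id[OF uE] by simp
    then obtain j where j: "Q.ord (nil_span #>\<^bsub>A\<^esub> u) = p ^ j" using prime divides_primepow_nat by blast
    have "j \<noteq> 0" using Q.ord_eq_1[OF uE] u_coset(2) j by auto
    then have "p dvd Q.ord (nil_span #>\<^bsub>A\<^esub> u)" using j by simp
    also have "\<dots> dvd card E" using Q.ord_dvd_group_order[OF uE] by (simp add: order_def E_def)
    finally show ?thesis .
  qed
  obtain n where n: "order H = p ^ n"
    using finite_p_group_order[OF H.is_group finite_H prime p_group] by blast
  \<comment> \<open>Multiplying cosets as sets avoids a choice of representatives. That the result
    is again a coset rests on \<open>f h\<close> mapping \<open>nil_span\<close> onto itself, which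
    holds because multiplication by the image of the inverse of \<open>h\<close> undoes it.\<close>
  define act where "act = (\<lambda>h C. (\<lambda>v. f h \<otimes> v) ` C)"
  have sub_C: "C \<subseteq> carrier R" if C: "C \<in> E" for C
    using C nil_span_D(2) gspan_closed by (auto simp: E coset)
  have act_coset: "act h (nil_span #>\<^bsub>A\<^esub> v) = nil_span #>\<^bsub>A\<^esub> (f h \<otimes> v)" if h: "h \<in> carrier H" and v: "v \<in> gspan" for h v
  proof -
    have "(\<lambda>w. f h \<otimes> w) ` nil_span = nil_span"
    proof
      show "(\<lambda>w. f h \<otimes> w) ` nil_span \<subseteq> nil_span" using nil_span_stable h by auto
      show "nil_span \<subseteq> (\<lambda>w. f h \<otimes> w) ` nil_span"
      proof
        fix w assume w: "w \<in> nil_span"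
        have "f h \<otimes> f (inv\<^bsub>H\<^esub> h) = \<one>" using f_mult[of h "inv\<^bsub>H\<^esub> h"] h by simp
        then have "w = f h \<otimes> (f (inv\<^bsub>H\<^esub> h) \<otimes> w)" using h nil_span_D(2)[OF w] by (simp flip: m_assoc)
        moreover have "f (inv\<^bsub>H\<^esub> h) \<otimes> w \<in> nil_span" using nil_span_stable w h by simp
        ultimately show "w \<in> (\<lambda>w. f h \<otimes> w) ` nil_span" by (rule image_eqI)
      qed
    qed
    moreover have "act h (nil_span #>\<^bsub>A\<^esub> v) = (\<lambda>w. w \<oplus> f h \<otimes> v) ` ((\<lambda>w. f h \<otimes> w) ` nil_span)"
      unfolding act_def coset image_image
      using nil_span_D(2) gspan_closed[OF v] h by (intro image_cong) (auto simp: r_distr)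
    ultimately show ?thesis by (simp add: coset)
  qed
  have act_E: "act h C \<in> E" if "h \<in> carrier H" "C \<in> E" for h C
    using that act_coset gspan_stable by (auto simp: E)
  have act_one: "act \<one>\<^bsub>H\<^esub> C = C" if C: "C \<in> E" for C
    using sub_C[OF C] by (force simp: act_def)
  have act_mult: "act (g \<otimes>\<^bsub>H\<^esub> h) C = act g (act h C)"
    if "g \<in> carrier H" "h \<in> carrier H" "C \<in> E" for g h C
    using that sub_C[OF that(3)] unfolding act_def image_image
    by (intro image_cong) (auto simp: f_mult m_assoc)
  have nil_span_coset: "nil_span = nil_span #>\<^bsub>A\<^esub> \<zero>"
    using nil_span_D(2) by (force simp: coset)
  have zero_gspan: "\<zero> \<in> gspan" using subgroup.one_closed[OF gspan_subgroup] by simp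
  have WE: "nil_span \<in> E" using nil_span_coset zero_gspan E by blast
  have act_nil_span: "act h nil_span = nil_span" if "h \<in> carrier H" for h
    using act_coset[OF that zero_gspan] that nil_span_coset by simp
  have "\<exists>C\<in>E. C \<noteq> nil_span \<and> (\<forall>h\<in>carrier H. act h C = C)"
    by (rule p_group_fixed_point[OF H.is_group n prime finE \<open>p dvd card E\<close>])
      (fact act_E act_one act_mult WE act_nil_span)+
  then obtain C where C: "C \<in> E" "C \<noteq> nil_span" "\<forall>h\<in>carrier H. act h C = C" by (elim bexE conjE)
  obtain v where v: "v \<in> gspan" "C = nil_span #>\<^bsub>A\<^esub> v" using C(1) E by blast
  have vc: "v \<in> carrier R" using v(1) by (rule gspan_closed)
  \<comment> \<open>That the coset of \<open>v\<close> is fixed means that (f h) v and v differ by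
    an element of \<open>nil_span\<close>, which is the hypothesis of
    \<open>nil_span_step\<close>.\<close>
  have "(f h \<ominus> \<one>) \<otimes> v \<in> nil_span" if h: "h \<in> carrier H" for h
  proof -
    have "nil_span #>\<^bsub>A\<^esub> (f h \<otimes> v) = nil_span #>\<^bsub>A\<^esub> v" using act_coset[OF h v(1)] C(3) h v(2) by simp
    moreover have "f h \<otimes> v \<in> nil_span #>\<^bsub>A\<^esub> (f h \<otimes> v)"
      using A.rcos_self[OF _ sub, of "f h \<otimes> v"] gspan_stable[OF v(1) h] A_simps(1) by simp
    ultimately obtain w where w: "w \<in> nil_span" "f h \<otimes> v = w \<oplus> v" by (auto simp: coset)
    have "(f h \<ominus> \<one>) \<otimes> v = f h \<otimes> v \<ominus> v" using h vc by (simp add: minus_eq l_distr l_minus)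
    also have "\<dots> = w" using w nil_span_D(2)[OF w(1)] vc by (simp add: minus_eq a_assoc r_neg)
    finally show ?thesis using w(1) by simp
  qed
  then have "v \<in> nil_span" using nil_span_step v(1) by simp
  then have "C = nil_span" using A.coset_join2[OF _ sub, of v] v A_simps(1) by simp
  then show False using C(2) by simp
qed

text \<open>This is the outcome of the counting: all products of some fixed number of factors
  \<open>f h\<close> minus 1 vanish.\<close>

lemma one_annihilated: "\<exists>n. \<one> \<in> ann n"
proof -
  have "f \<one>\<^bsub>H\<^esub> \<in> f ` carrier H" by (rule imageI) simp
  then have "\<one> \<in> nil_span" unfolding nil_span_eq_gspan gspan_def by (auto intro: generate.incl)
  then show ?thesis by (auto simp: nil_span_def)
qed

text \<open>Let d be the sum. In a power of d the factors f h - 1 are collected next to each other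
  by moving the coefficients out of the way, which needs only that coefficients commute with the
  \<open>f h\<close>. Products with sufficiently many such factors are zero.\<close>

lemma augmentation_nilpotent:
  assumes r: "\<And>h. h \<in> carrier H \<Longrightarrow> r h \<in> carrier R"
    and comm: "\<And>g h. g \<in> carrier H \<Longrightarrow> h \<in> carrier H \<Longrightarrow> r g \<otimes> f h = f h \<otimes> r g"
  shows "(\<Oplus>h\<in>carrier H. r h \<otimes> (f h \<ominus> \<one>)) \<in> nilpotents R"
proof -
  define d where "d = (\<Oplus>h\<in>carrier H. r h \<otimes> (f h \<ominus> \<one>))"
  have d: "d \<in> carrier R" unfolding d_def using r by (intro finsum_closed) auto
  \<comment> \<open>The induction ranges over all \<open>x\<close> commuting with the coefficients,
    since each step replaces \<open>x\<close> by y = (f h - 1) x, one level lower and still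
    commuting with them. The coefficient is then moved to the right of \<open>y\<close>, where it
    does not disturb the induction hypothesis.\<close>
  have "d [^] n \<otimes> x = \<zero>"
    if "x \<in> ann n" "\<And>h. h \<in> carrier H \<Longrightarrow> r h \<otimes> x = x \<otimes> r h" for n x
    using that
  proof (induction n arbitrary: x)
    case (Suc n)
    have x: "x \<in> carrier R" using Suc.prems(1) by simp
    have zero: "d [^] n \<otimes> (r h \<otimes> (f h \<ominus> \<one>) \<otimes> x) = \<zero>" if h: "h \<in> carrier H" for h
    proof -
      define y where "y = (f h \<ominus> \<one>) \<otimes> x"
      have y: "y \<in> ann n" "y \<in> carrier R" using Suc.prems(1) h x by (simp_all add: y_def)
      have com: "r g \<otimes> y = y \<otimes> r g" if g: "g \<in> carrier H" for g
      proof -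
        have "r g \<otimes> (f h \<ominus> \<one>) = (f h \<ominus> \<one>) \<otimes> r g"
          using comm[OF g h] r[OF g] h by (simp add: minus_eq r_distr l_distr r_minus l_minus)
        then have "r g \<otimes> y = (f h \<ominus> \<one>) \<otimes> (r g \<otimes> x)"
          unfolding y_def using r[OF g] h x by (simp flip: m_assoc)
        then show ?thesis using Suc.prems(2)[OF g] r[OF g] h x by (simp add: y_def m_assoc)
      qed
      have "d [^] n \<otimes> (r h \<otimes> (f h \<ominus> \<one>) \<otimes> x) = d [^] n \<otimes> (r h \<otimes> y)"
        using r[OF h] h x by (simp add: y_def m_assoc)
      also have "\<dots> = (d [^] n \<otimes> y) \<otimes> r h"
        using com[OF h] r[OF h] y(2) d by (simp add: m_assoc)
      also have "\<dots> = \<zero>" using Suc.IH[OF y(1) com] r[OF h] by simp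
      finally show ?thesis .
    qed
    have "d [^] Suc n \<otimes> x = d [^] n \<otimes> (d \<otimes> x)" using d x by (simp add: m_assoc)
    also have "d \<otimes> x = (\<Oplus>h\<in>carrier H. r h \<otimes> (f h \<ominus> \<one>) \<otimes> x)"
      unfolding d_def using finite_H x r by (intro finsum_ldistr) auto
    also have "d [^] n \<otimes> \<dots> = (\<Oplus>h\<in>carrier H. d [^] n \<otimes> (r h \<otimes> (f h \<ominus> \<one>) \<otimes> x))"
      using finite_H x r d by (intro finsum_rdistr) auto
    also have "\<dots> = \<zero>" using zero by (intro add.finprod_one_eqI) simp
    finally show ?case .
  qed (use d in auto)
  moreover obtain n where n: "\<one> \<in> ann n" using one_annihilated by blast
  \<comment> \<open>The exponent is raised by one because \<open>nilpotents\<close> asks for a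
    positive exponent and \<open>n\<close> may be 0.\<close>
  ultimately have "d [^] Suc n = \<zero>" using ann_Suc[OF n] r d by (metis l_one r_one nat_pow_closed)
  then show ?thesis using d unfolding d_def nilpotents_def by (auto intro!: exI[of _ "Suc n"])
qed

end

section \<open>The group ring\<close>

lemma (in abelian_monoid) finsum_swap:
  assumes "finite A" "finite B" "\<And>a b. a \<in> A \<Longrightarrow> b \<in> B \<Longrightarrow> f a b \<in> carrier G"
  shows "(\<Oplus>a\<in>A. \<Oplus>b\<in>B. f a b) = (\<Oplus>b\<in>B. \<Oplus>a\<in>A. f a b)"
  using assms
proof (induction A rule: finite_induct)
  case empty
  have "(\<Oplus>b\<in>B. \<Oplus>a\<in>{}. f a b) = \<zero>" by (rule add.finprod_one_eqI) simp
  then show ?case by simp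
next
  case (insert x A)
  have "(\<Oplus>b\<in>B. \<Oplus>a\<in>insert x A. f a b) = (\<Oplus>b\<in>B. f x b \<oplus> (\<Oplus>a\<in>A. f a b))"
    using insert by (intro add.finprod_cong') (auto intro!: finsum_closed)
  also have "\<dots> = (\<Oplus>b\<in>B. f x b) \<oplus> (\<Oplus>b\<in>B. \<Oplus>a\<in>A. f a b)"
    using insert by (intro add.finprod_multf) (auto intro!: finsum_closed)
  also have "\<dots> = (\<Oplus>b\<in>B. f x b) \<oplus> (\<Oplus>a\<in>A. \<Oplus>b\<in>B. f a b)"
    using insert by simp
  finally show ?case
    using insert by (simp add: finsum_closed Pi_def)
qed

lemma (in abelian_monoid) finsum_eq_superset:
  assumes "finite B" "A \<subseteq> B" "\<And>i. i \<in> B - A \<Longrightarrow> f i = \<zero>" "f \<in> B \<rightarrow> carrier G"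
  shows "finsum G f A = finsum G f B"
proof (rule add.finprod_mono_neutral_cong_left[OF assms(1,2)])
  show "f i = \<zero>" if "i \<in> B - A" for i using assms(3)[OF that] .
  show "f \<in> B \<rightarrow> carrier G" by (rule assms(4))
qed (rule refl)

locale group_ring_context = R: ring R + G: group G for R (structure) and G (structure)
begin

abbreviation RG where "RG \<equiv> group_ring R G"
abbreviation supp where "supp \<equiv> coeff_support R G"

section \<open>Coefficients and the convolution product\<close>

lemma carrier_RG: "f \<in> carrier RG \<longleftrightarrow> f \<in> carrier G \<rightarrow>\<^sub>E carrier R \<and> finite (supp f)"
  by (simp add: group_ring_def)

lemma add_coeff: "x \<in> carrier G \<Longrightarrow> (f \<oplus>\<^bsub>RG\<^esub> h) x = f x \<oplus>\<^bsub>R\<^esub> h x"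
  by (simp add: group_ring_def)

lemma zero_coeff: "x \<in> carrier G \<Longrightarrow> \<zero>\<^bsub>RG\<^esub> x = \<zero>\<^bsub>R\<^esub>"
  by (simp add: group_ring_def)

lemma one_coeff: "x \<in> carrier G \<Longrightarrow> \<one>\<^bsub>RG\<^esub> x = (if x = \<one>\<^bsub>G\<^esub> then \<one>\<^bsub>R\<^esub> else \<zero>\<^bsub>R\<^esub>)"
  by (simp add: group_ring_def)

lemma mult_coeff:
  "x \<in> carrier G \<Longrightarrow> (f \<otimes>\<^bsub>RG\<^esub> h) x =
     finsum R (\<lambda>(a, b). f a \<otimes>\<^bsub>R\<^esub> h b) {(a, b). a \<in> supp f \<and> b \<in> supp h \<and> a \<otimes>\<^bsub>G\<^esub> b = x}"
  by (simp add: group_ring_def)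

lemma RG_extensional:
  "f \<oplus>\<^bsub>RG\<^esub> h \<in> extensional (carrier G)" "f \<otimes>\<^bsub>RG\<^esub> h \<in> extensional (carrier G)"
  "\<zero>\<^bsub>RG\<^esub> \<in> extensional (carrier G)" "\<one>\<^bsub>RG\<^esub> \<in> extensional (carrier G)"
  by (simp_all add: group_ring_def)

lemma coeff_closed [simp]: "f \<in> carrier RG \<Longrightarrow> x \<in> carrier G \<Longrightarrow> f x \<in> carrier R"
  unfolding carrier_RG using PiE_mem[of f "carrier G" "\<lambda>_. carrier R" x] by simp

lemma finite_supp [simp]: "f \<in> carrier RG \<Longrightarrow> finite (supp f)"
  by (simp add: carrier_RG)

lemma supp_subset: "supp f \<subseteq> carrier G"
  by (auto simp: coeff_support_def)

lemma notin_supp: "x \<in> carrier G \<Longrightarrow> x \<notin> supp f \<Longrightarrow> f x = \<zero>\<^bsub>R\<^esub>"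
  by (auto simp: coeff_support_def)

lemma RG_ext:
  assumes "f \<in> carrier RG" "h \<in> carrier RG" "\<And>x. x \<in> carrier G \<Longrightarrow> f x = h x"
  shows "f = h"
proof (rule PiE_ext)
  show "f \<in> carrier G \<rightarrow>\<^sub>E carrier R" "h \<in> carrier G \<rightarrow>\<^sub>E carrier R"
    using assms(1,2) by (simp_all add: carrier_RG)
qed (rule assms(3))

lemma RG_I:
  assumes "finite A" "f \<in> extensional (carrier G)" "\<And>x. x \<in> carrier G \<Longrightarrow> f x \<in> carrier R"
    "\<And>x. x \<in> carrier G \<Longrightarrow> x \<notin> A \<Longrightarrow> f x = \<zero>\<^bsub>R\<^esub>"
  shows "f \<in> carrier RG"
proof -
  have "supp f \<subseteq> A" using assms(4) by (auto simp: coeff_support_def)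
  then have "finite (supp f)" using assms(1) by (rule finite_subset)
  moreover have "f \<in> carrier G \<rightarrow>\<^sub>E carrier R"
    using assms(2,3) by (intro PiE_I) (auto dest: extensional_arb)
  ultimately show ?thesis by (simp only: carrier_RG)
qed

lemma RG_add_closed:
  assumes "f \<in> carrier RG" "h \<in> carrier RG" shows "f \<oplus>\<^bsub>RG\<^esub> h \<in> carrier RG"
proof (rule RG_I[of "supp f \<union> supp h"])
  show "f \<oplus>\<^bsub>RG\<^esub> h \<in> extensional (carrier G)" by (rule RG_extensional)
qed (use assms in \<open>simp_all add: add_coeff notin_supp[of _ f] notin_supp[of _ h]\<close>)

lemma RG_zero_closed: "\<zero>\<^bsub>RG\<^esub> \<in> carrier RG"
proof (rule RG_I[of "{}"])
  show "\<zero>\<^bsub>RG\<^esub> \<in> extensional (carrier G)" by (rule RG_extensional)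
qed (auto simp: zero_coeff)

lemma RG_one_closed: "\<one>\<^bsub>RG\<^esub> \<in> carrier RG"
proof (rule RG_I[of "{\<one>\<^bsub>G\<^esub>}"])
  show "\<one>\<^bsub>RG\<^esub> \<in> extensional (carrier G)" by (rule RG_extensional)
qed (auto simp: one_coeff)

text \<open>The condition a b = x determines b from a, so the sum over pairs becomes a sum over a
  alone. Any finite \<open>A\<close> containing the support is allowed; the extra terms are
  zero.\<close>

lemma mult_coeff_left:
  assumes f: "f \<in> carrier RG" and h: "h \<in> carrier RG" and x: "x \<in> carrier G"
    and A: "finite A" "supp f \<subseteq> A" "A \<subseteq> carrier G"
  shows "(f \<otimes>\<^bsub>RG\<^esub> h) x = (\<Oplus>\<^bsub>R\<^esub>a\<in>A. f a \<otimes>\<^bsub>R\<^esub> h (inv\<^bsub>G\<^esub> a \<otimes>\<^bsub>G\<^esub> x))"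
proof -
  let ?P = "{(a, b). a \<in> supp f \<and> b \<in> supp h \<and> a \<otimes>\<^bsub>G\<^esub> b = x}"
  let ?B = "{a \<in> supp f. inv\<^bsub>G\<^esub> a \<otimes>\<^bsub>G\<^esub> x \<in> supp h}"
  have inG: "\<And>a. a \<in> A \<Longrightarrow> a \<in> carrier G" "\<And>a. a \<in> supp f \<Longrightarrow> a \<in> carrier G"
    "\<And>a. a \<in> supp h \<Longrightarrow> a \<in> carrier G"
    using A supp_subset by blast+
  have P: "?P = (\<lambda>a. (a, inv\<^bsub>G\<^esub> a \<otimes>\<^bsub>G\<^esub> x)) ` ?B"
  proof (intro equalityI subsetI)
    fix z assume "z \<in> ?P"
    then obtain a b where z: "z = (a, b)" "a \<in> supp f" "b \<in> supp h" "a \<otimes>\<^bsub>G\<^esub> b = x" by auto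
    then have "b = inv\<^bsub>G\<^esub> a \<otimes>\<^bsub>G\<^esub> x" using inG G.inv_solve_left[of b a x] x by auto
    then show "z \<in> (\<lambda>a. (a, inv\<^bsub>G\<^esub> a \<otimes>\<^bsub>G\<^esub> x)) ` ?B" using z by auto
  next
    fix z assume "z \<in> (\<lambda>a. (a, inv\<^bsub>G\<^esub> a \<otimes>\<^bsub>G\<^esub> x)) ` ?B"
    then show "z \<in> ?P" using inG x by (auto simp flip: G.m_assoc)
  qed
  have "(f \<otimes>\<^bsub>RG\<^esub> h) x = finsum R (\<lambda>(a, b). f a \<otimes>\<^bsub>R\<^esub> h b) ?P"
    by (rule mult_coeff[OF x])
  also have "\<dots> = (\<Oplus>\<^bsub>R\<^esub>a\<in>?B. f a \<otimes>\<^bsub>R\<^esub> h (inv\<^bsub>G\<^esub> a \<otimes>\<^bsub>G\<^esub> x))"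
    unfolding P using f h x inG
    by (subst R.add.finprod_reindex) (auto simp: inj_on_def)
  also have "\<dots> = (\<Oplus>\<^bsub>R\<^esub>a\<in>A. f a \<otimes>\<^bsub>R\<^esub> h (inv\<^bsub>G\<^esub> a \<otimes>\<^bsub>G\<^esub> x))"
  proof (rule R.finsum_eq_superset[OF A(1)])
    show "?B \<subseteq> A" using A by auto
    fix a assume "a \<in> A - ?B"
    then consider "a \<in> carrier G" "f a = \<zero>\<^bsub>R\<^esub>" | "a \<in> carrier G" "h (inv\<^bsub>G\<^esub> a \<otimes>\<^bsub>G\<^esub> x) = \<zero>\<^bsub>R\<^esub>"
      using inG x notin_supp[of a f] notin_supp[of "inv\<^bsub>G\<^esub> a \<otimes>\<^bsub>G\<^esub> x" h] by auto
    then show "f a \<otimes>\<^bsub>R\<^esub> h (inv\<^bsub>G\<^esub> a \<otimes>\<^bsub>G\<^esub> x) = \<zero>\<^bsub>R\<^esub>" using f h x by cases auto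
  qed (use f h x inG in auto)
  finally show ?thesis .
qed

text \<open>Obtained from the left form by the substitution a = x b^(-1). The index set now depends
  on the right factor only, which is what \<open>RG_l_distr\<close> needs when the left factor
  varies.\<close>

lemma mult_coeff_right:
  assumes f: "f \<in> carrier RG" and h: "h \<in> carrier RG" and x: "x \<in> carrier G"
    and B: "finite B" "supp h \<subseteq> B" "B \<subseteq> carrier G"
  shows "(f \<otimes>\<^bsub>RG\<^esub> h) x = (\<Oplus>\<^bsub>R\<^esub>b\<in>B. f (x \<otimes>\<^bsub>G\<^esub> inv\<^bsub>G\<^esub> b) \<otimes>\<^bsub>R\<^esub> h b)"
proof -
  let ?t = "\<lambda>b. x \<otimes>\<^bsub>G\<^esub> inv\<^bsub>G\<^esub> b"
  let ?A = "supp f \<union> ?t ` B"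
  have inG: "\<And>a. a \<in> B \<Longrightarrow> a \<in> carrier G" "\<And>a. a \<in> supp f \<Longrightarrow> a \<in> carrier G"
    "\<And>a. a \<in> supp h \<Longrightarrow> a \<in> carrier G"
    using B supp_subset by blast+
  have inv_left: "inv\<^bsub>G\<^esub> (?t b) \<otimes>\<^bsub>G\<^esub> x = b" if "b \<in> carrier G" for b
    using that x by (simp add: G.inv_mult_group G.m_assoc)
  have inv_right: "?t (inv\<^bsub>G\<^esub> a \<otimes>\<^bsub>G\<^esub> x) = a" if "a \<in> carrier G" for a
    using that x by (simp add: G.inv_mult_group flip: G.m_assoc)
  have inj: "inj_on ?t B" using inv_left inG by (intro inj_on_inverseI[of _ "\<lambda>a. inv\<^bsub>G\<^esub> a \<otimes>\<^bsub>G\<^esub> x"]) auto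
  have "(f \<otimes>\<^bsub>RG\<^esub> h) x = (\<Oplus>\<^bsub>R\<^esub>a\<in>?A. f a \<otimes>\<^bsub>R\<^esub> h (inv\<^bsub>G\<^esub> a \<otimes>\<^bsub>G\<^esub> x))"
    using inG x B f h by (intro mult_coeff_left) auto
  also have "\<dots> = (\<Oplus>\<^bsub>R\<^esub>a\<in>?t ` B. f a \<otimes>\<^bsub>R\<^esub> h (inv\<^bsub>G\<^esub> a \<otimes>\<^bsub>G\<^esub> x))"
  proof (rule R.finsum_eq_superset[symmetric])
    fix a assume a: "a \<in> ?A - ?t ` B"
    then have aG: "a \<in> carrier G" using inG x by auto
    have "inv\<^bsub>G\<^esub> a \<otimes>\<^bsub>G\<^esub> x \<notin> supp h"
      using a inv_right[OF aG] B by (metis DiffD2 image_eqI subsetD)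
    then show "f a \<otimes>\<^bsub>R\<^esub> h (inv\<^bsub>G\<^esub> a \<otimes>\<^bsub>G\<^esub> x) = \<zero>\<^bsub>R\<^esub>"
      using aG x f notin_supp[of "inv\<^bsub>G\<^esub> a \<otimes>\<^bsub>G\<^esub> x" h] by simp
  qed (use inG x B f h in auto)
  also have "\<dots> = (\<Oplus>\<^bsub>R\<^esub>b\<in>B. f (?t b) \<otimes>\<^bsub>R\<^esub> h (inv\<^bsub>G\<^esub> (?t b) \<otimes>\<^bsub>G\<^esub> x))"
    using inj inG x f h by (subst R.add.finprod_reindex) auto
  also have "\<dots> = (\<Oplus>\<^bsub>R\<^esub>b\<in>B. f (?t b) \<otimes>\<^bsub>R\<^esub> h b)"
    using inG x f h inv_left by (intro R.add.finprod_cong') auto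
  finally show ?thesis .
qed

lemma mult_support:
  assumes f: "f \<in> carrier RG" and h: "h \<in> carrier RG" and x: "x \<in> carrier G"
    and "x \<notin> (\<lambda>(a, b). a \<otimes>\<^bsub>G\<^esub> b) ` (supp f \<times> supp h)"
  shows "(f \<otimes>\<^bsub>RG\<^esub> h) x = \<zero>\<^bsub>R\<^esub>"
proof -
  have "{(a, b). a \<in> supp f \<and> b \<in> supp h \<and> a \<otimes>\<^bsub>G\<^esub> b = x} = {}" using assms(4) by force
  then show ?thesis by (simp only: mult_coeff[OF x] R.finsum_empty)
qed

lemma RG_mult_closed:
  assumes f: "f \<in> carrier RG" and h: "h \<in> carrier RG"
  shows "f \<otimes>\<^bsub>RG\<^esub> h \<in> carrier RG"
proof (rule RG_I[of "(\<lambda>(a, b). a \<otimes>\<^bsub>G\<^esub> b) ` (supp f \<times> supp h)"])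
  show "f \<otimes>\<^bsub>RG\<^esub> h \<in> extensional (carrier G)" by (rule RG_extensional)
  show "(f \<otimes>\<^bsub>RG\<^esub> h) x \<in> carrier R" if x: "x \<in> carrier G" for x
    unfolding mult_coeff_left[OF f h x finite_supp[OF f] order_refl supp_subset]
    using f h x supp_subset by (intro R.finsum_closed) (auto dest: subsetD[OF supp_subset])
qed (use f h mult_support in auto)

lemma RG_l_distr:
  assumes f: "f \<in> carrier RG" and g: "g \<in> carrier RG" and h: "h \<in> carrier RG"
  shows "(f \<oplus>\<^bsub>RG\<^esub> g) \<otimes>\<^bsub>RG\<^esub> h = f \<otimes>\<^bsub>RG\<^esub> h \<oplus>\<^bsub>RG\<^esub> g \<otimes>\<^bsub>RG\<^esub> h"
proof (rule RG_ext)
  fix x assume x: "x \<in> carrier G"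
  have S: "\<And>b. b \<in> supp h \<Longrightarrow> b \<in> carrier G" using supp_subset by blast
  note expand = mult_coeff_right[OF _ h x finite_supp[OF h] order_refl supp_subset]
  have "((f \<oplus>\<^bsub>RG\<^esub> g) \<otimes>\<^bsub>RG\<^esub> h) x
      = (\<Oplus>\<^bsub>R\<^esub>b\<in>supp h. f (x \<otimes>\<^bsub>G\<^esub> inv\<^bsub>G\<^esub> b) \<otimes>\<^bsub>R\<^esub> h b \<oplus>\<^bsub>R\<^esub> g (x \<otimes>\<^bsub>G\<^esub> inv\<^bsub>G\<^esub> b) \<otimes>\<^bsub>R\<^esub> h b)"
    unfolding expand[OF RG_add_closed[OF f g]]
    using assms x S by (intro R.add.finprod_cong') (auto simp: add_coeff R.l_distr)
  also have "\<dots> = (f \<otimes>\<^bsub>RG\<^esub> h) x \<oplus>\<^bsub>R\<^esub> (g \<otimes>\<^bsub>RG\<^esub> h) x"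
    unfolding expand[OF f] expand[OF g] using assms x S by (intro R.add.finprod_multf) auto
  finally show "((f \<oplus>\<^bsub>RG\<^esub> g) \<otimes>\<^bsub>RG\<^esub> h) x = (f \<otimes>\<^bsub>RG\<^esub> h \<oplus>\<^bsub>RG\<^esub> g \<otimes>\<^bsub>RG\<^esub> h) x"
    using x by (simp add: add_coeff)
qed (use assms in \<open>auto intro!: RG_add_closed RG_mult_closed\<close>)

lemma RG_r_distr:
  assumes f: "f \<in> carrier RG" and g: "g \<in> carrier RG" and h: "h \<in> carrier RG"
  shows "h \<otimes>\<^bsub>RG\<^esub> (f \<oplus>\<^bsub>RG\<^esub> g) = h \<otimes>\<^bsub>RG\<^esub> f \<oplus>\<^bsub>RG\<^esub> h \<otimes>\<^bsub>RG\<^esub> g"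
proof (rule RG_ext)
  fix x assume x: "x \<in> carrier G"
  have S: "\<And>b. b \<in> supp h \<Longrightarrow> b \<in> carrier G" using supp_subset by blast
  note expand = mult_coeff_left[OF h _ x finite_supp[OF h] order_refl supp_subset]
  have "(h \<otimes>\<^bsub>RG\<^esub> (f \<oplus>\<^bsub>RG\<^esub> g)) x
      = (\<Oplus>\<^bsub>R\<^esub>a\<in>supp h. h a \<otimes>\<^bsub>R\<^esub> f (inv\<^bsub>G\<^esub> a \<otimes>\<^bsub>G\<^esub> x) \<oplus>\<^bsub>R\<^esub> h a \<otimes>\<^bsub>R\<^esub> g (inv\<^bsub>G\<^esub> a \<otimes>\<^bsub>G\<^esub> x))"
    unfolding expand[OF RG_add_closed[OF f g]]
    using assms x S by (intro R.add.finprod_cong') (auto simp: add_coeff R.r_distr)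
  also have "\<dots> = (h \<otimes>\<^bsub>RG\<^esub> f) x \<oplus>\<^bsub>R\<^esub> (h \<otimes>\<^bsub>RG\<^esub> g) x"
    unfolding expand[OF f] expand[OF g] using assms x S by (intro R.add.finprod_multf) auto
  finally show "(h \<otimes>\<^bsub>RG\<^esub> (f \<oplus>\<^bsub>RG\<^esub> g)) x = (h \<otimes>\<^bsub>RG\<^esub> f \<oplus>\<^bsub>RG\<^esub> h \<otimes>\<^bsub>RG\<^esub> g) x"
    using x by (simp add: add_coeff)
qed (use assms in \<open>auto intro!: RG_add_closed RG_mult_closed\<close>)

text \<open>One product is expanded over the support of the right factor and the other over that of
  the left factor. Both bracketings become double sums over the same two fixed sets, so swapping the
  summations suffices.\<close>

lemma RG_assoc:
  assumes f: "f \<in> carrier RG" and g: "g \<in> carrier RG" and h: "h \<in> carrier RG"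
  shows "(f \<otimes>\<^bsub>RG\<^esub> g) \<otimes>\<^bsub>RG\<^esub> h = f \<otimes>\<^bsub>RG\<^esub> (g \<otimes>\<^bsub>RG\<^esub> h)"
proof (rule RG_ext)
  fix x assume x: "x \<in> carrier G"
  have S: "\<And>b. b \<in> supp h \<Longrightarrow> b \<in> carrier G" "\<And>a. a \<in> supp f \<Longrightarrow> a \<in> carrier G"
    using supp_subset by blast+
  have "((f \<otimes>\<^bsub>RG\<^esub> g) \<otimes>\<^bsub>RG\<^esub> h) x = (\<Oplus>\<^bsub>R\<^esub>b\<in>supp h. (f \<otimes>\<^bsub>RG\<^esub> g) (x \<otimes>\<^bsub>G\<^esub> inv\<^bsub>G\<^esub> b) \<otimes>\<^bsub>R\<^esub> h b)"
    using assms x by (intro mult_coeff_right) (auto simp: RG_mult_closed supp_subset)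
  also have "\<dots> = (\<Oplus>\<^bsub>R\<^esub>b\<in>supp h. \<Oplus>\<^bsub>R\<^esub>a\<in>supp f.
      f a \<otimes>\<^bsub>R\<^esub> g (inv\<^bsub>G\<^esub> a \<otimes>\<^bsub>G\<^esub> (x \<otimes>\<^bsub>G\<^esub> inv\<^bsub>G\<^esub> b)) \<otimes>\<^bsub>R\<^esub> h b)"
  proof (rule R.add.finprod_cong')
    fix b assume b: "b \<in> supp h"
    have "(f \<otimes>\<^bsub>RG\<^esub> g) (x \<otimes>\<^bsub>G\<^esub> inv\<^bsub>G\<^esub> b) = (\<Oplus>\<^bsub>R\<^esub>a\<in>supp f. f a \<otimes>\<^bsub>R\<^esub> g (inv\<^bsub>G\<^esub> a \<otimes>\<^bsub>G\<^esub> (x \<otimes>\<^bsub>G\<^esub> inv\<^bsub>G\<^esub> b)))"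
      using assms x S b by (intro mult_coeff_left) (auto simp: supp_subset)
    then show "(f \<otimes>\<^bsub>RG\<^esub> g) (x \<otimes>\<^bsub>G\<^esub> inv\<^bsub>G\<^esub> b) \<otimes>\<^bsub>R\<^esub> h b = (\<Oplus>\<^bsub>R\<^esub>a\<in>supp f.
      f a \<otimes>\<^bsub>R\<^esub> g (inv\<^bsub>G\<^esub> a \<otimes>\<^bsub>G\<^esub> (x \<otimes>\<^bsub>G\<^esub> inv\<^bsub>G\<^esub> b)) \<otimes>\<^bsub>R\<^esub> h b)"
      using assms x S b by (simp, intro R.finsum_ldistr) auto
  qed (use assms x S in \<open>auto intro!: R.finsum_closed\<close>)
  also have "\<dots> = (\<Oplus>\<^bsub>R\<^esub>a\<in>supp f. \<Oplus>\<^bsub>R\<^esub>b\<in>supp h.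
      f a \<otimes>\<^bsub>R\<^esub> g (inv\<^bsub>G\<^esub> a \<otimes>\<^bsub>G\<^esub> (x \<otimes>\<^bsub>G\<^esub> inv\<^bsub>G\<^esub> b)) \<otimes>\<^bsub>R\<^esub> h b)"
    using assms x S by (intro R.finsum_swap) auto
  also have "\<dots> = (\<Oplus>\<^bsub>R\<^esub>a\<in>supp f. f a \<otimes>\<^bsub>R\<^esub> (g \<otimes>\<^bsub>RG\<^esub> h) (inv\<^bsub>G\<^esub> a \<otimes>\<^bsub>G\<^esub> x))"
  proof (rule R.add.finprod_cong')
    fix a assume a: "a \<in> supp f"
    have "(g \<otimes>\<^bsub>RG\<^esub> h) (inv\<^bsub>G\<^esub> a \<otimes>\<^bsub>G\<^esub> x) = (\<Oplus>\<^bsub>R\<^esub>b\<in>supp h. g ((inv\<^bsub>G\<^esub> a \<otimes>\<^bsub>G\<^esub> x) \<otimes>\<^bsub>G\<^esub> inv\<^bsub>G\<^esub> b) \<otimes>\<^bsub>R\<^esub> h b)"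
      using assms x S a by (intro mult_coeff_right) (auto simp: supp_subset)
    then have "f a \<otimes>\<^bsub>R\<^esub> (g \<otimes>\<^bsub>RG\<^esub> h) (inv\<^bsub>G\<^esub> a \<otimes>\<^bsub>G\<^esub> x)
        = (\<Oplus>\<^bsub>R\<^esub>b\<in>supp h. f a \<otimes>\<^bsub>R\<^esub> (g ((inv\<^bsub>G\<^esub> a \<otimes>\<^bsub>G\<^esub> x) \<otimes>\<^bsub>G\<^esub> inv\<^bsub>G\<^esub> b) \<otimes>\<^bsub>R\<^esub> h b))"
      using assms x S a by (simp, intro R.finsum_rdistr) auto
    also have "\<dots> = (\<Oplus>\<^bsub>R\<^esub>b\<in>supp h. f a \<otimes>\<^bsub>R\<^esub> g (inv\<^bsub>G\<^esub> a \<otimes>\<^bsub>G\<^esub> (x \<otimes>\<^bsub>G\<^esub> inv\<^bsub>G\<^esub> b)) \<otimes>\<^bsub>R\<^esub> h b)"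
      using assms x S a by (intro R.add.finprod_cong') (auto simp: R.m_assoc G.m_assoc)
    finally show "(\<Oplus>\<^bsub>R\<^esub>b\<in>supp h. f a \<otimes>\<^bsub>R\<^esub> g (inv\<^bsub>G\<^esub> a \<otimes>\<^bsub>G\<^esub> (x \<otimes>\<^bsub>G\<^esub> inv\<^bsub>G\<^esub> b)) \<otimes>\<^bsub>R\<^esub> h b)
      = f a \<otimes>\<^bsub>R\<^esub> (g \<otimes>\<^bsub>RG\<^esub> h) (inv\<^bsub>G\<^esub> a \<otimes>\<^bsub>G\<^esub> x)" by simp
  qed (use assms x S in \<open>auto simp: RG_mult_closed\<close>)
  also have "\<dots> = (f \<otimes>\<^bsub>RG\<^esub> (g \<otimes>\<^bsub>RG\<^esub> h)) x"
    using assms x by (intro mult_coeff_left[symmetric]) (auto simp: RG_mult_closed supp_subset)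
  finally show "((f \<otimes>\<^bsub>RG\<^esub> g) \<otimes>\<^bsub>RG\<^esub> h) x = (f \<otimes>\<^bsub>RG\<^esub> (g \<otimes>\<^bsub>RG\<^esub> h)) x" .
qed (use assms in \<open>auto intro!: RG_mult_closed\<close>)

definition monomial :: "'a \<Rightarrow> 'c \<Rightarrow> 'c \<Rightarrow> 'a" where
  "monomial r g = (\<lambda>x\<in>carrier G. if x = g then r else \<zero>\<^bsub>R\<^esub>)"

lemma monomial_coeff: "x \<in> carrier G \<Longrightarrow> monomial r g x = (if x = g then r else \<zero>\<^bsub>R\<^esub>)"
  by (simp add: monomial_def)

lemma monomial_closed [simp]: "r \<in> carrier R \<Longrightarrow> monomial r g \<in> carrier RG"
  by (rule RG_I[of "{g}"]) (auto simp: monomial_def)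

lemma supp_monomial: "supp (monomial r g) \<subseteq> {g}"
  by (auto simp: coeff_support_def monomial_def)

lemma monomial_mult_coeff:
  assumes "r \<in> carrier R" "g \<in> carrier G" "f \<in> carrier RG" "x \<in> carrier G"
  shows "(monomial r g \<otimes>\<^bsub>RG\<^esub> f) x = r \<otimes>\<^bsub>R\<^esub> f (inv\<^bsub>G\<^esub> g \<otimes>\<^bsub>G\<^esub> x)"
  using assms supp_monomial by (subst mult_coeff_left[of _ _ _ "{g}"]) (auto simp: monomial_coeff)

lemma mult_monomial_coeff:
  assumes "r \<in> carrier R" "g \<in> carrier G" "f \<in> carrier RG" "x \<in> carrier G"
  shows "(f \<otimes>\<^bsub>RG\<^esub> monomial r g) x = f (x \<otimes>\<^bsub>G\<^esub> inv\<^bsub>G\<^esub> g) \<otimes>\<^bsub>R\<^esub> r"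
  using assms supp_monomial by (subst mult_coeff_right[of _ _ _ "{g}"]) (auto simp: monomial_coeff)

lemma one_eq_monomial: "\<one>\<^bsub>RG\<^esub> = monomial \<one>\<^bsub>R\<^esub> \<one>\<^bsub>G\<^esub>"
  by (intro RG_ext RG_one_closed monomial_closed) (auto simp: one_coeff monomial_coeff)

lemma ring_RG: "ring RG"
proof (rule ringI)
  show "abelian_group RG"
  proof (rule abelian_groupI)
    fix f assume f: "f \<in> carrier RG"
    let ?m = "\<lambda>x\<in>carrier G. \<ominus>\<^bsub>R\<^esub> f x"
    have m: "?m \<in> carrier RG" using f by (intro RG_I[of "supp f"]) (auto simp: notin_supp[of _ f])
    have "?m \<oplus>\<^bsub>RG\<^esub> f = \<zero>\<^bsub>RG\<^esub>"
      using m f by (intro RG_ext RG_add_closed RG_zero_closed) (auto simp: add_coeff zero_coeff R.l_neg)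
    then show "\<exists>y\<in>carrier RG. y \<oplus>\<^bsub>RG\<^esub> f = \<zero>\<^bsub>RG\<^esub>" using m by blast
    show "\<zero>\<^bsub>RG\<^esub> \<oplus>\<^bsub>RG\<^esub> f = f"
      using f by (intro RG_ext RG_add_closed RG_zero_closed) (auto simp: add_coeff zero_coeff)
  next
    fix f g h assume "f \<in> carrier RG" "g \<in> carrier RG" "h \<in> carrier RG"
    then show "(f \<oplus>\<^bsub>RG\<^esub> g) \<oplus>\<^bsub>RG\<^esub> h = f \<oplus>\<^bsub>RG\<^esub> (g \<oplus>\<^bsub>RG\<^esub> h)"
      by (intro RG_ext RG_add_closed) (auto simp: add_coeff R.a_assoc)
  next
    fix f g assume "f \<in> carrier RG" "g \<in> carrier RG"
    then show "f \<oplus>\<^bsub>RG\<^esub> g = g \<oplus>\<^bsub>RG\<^esub> f"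
      by (intro RG_ext RG_add_closed) (auto simp: add_coeff R.a_comm)
  qed (auto intro: RG_add_closed RG_zero_closed)
  show "monoid RG"
  proof (rule monoidI)
    fix f assume f: "f \<in> carrier RG"
    show "\<one>\<^bsub>RG\<^esub> \<otimes>\<^bsub>RG\<^esub> f = f" "f \<otimes>\<^bsub>RG\<^esub> \<one>\<^bsub>RG\<^esub> = f"
      unfolding one_eq_monomial using f
      by (auto intro!: RG_ext RG_mult_closed simp: monomial_mult_coeff mult_monomial_coeff)
  qed (auto intro: RG_mult_closed RG_one_closed RG_assoc)
qed (auto intro: RG_l_distr RG_r_distr)

end

lemma (in ring) add_pow_one_mult:
  "[(m * n :: nat)] \<cdot> \<one> = [m] \<cdot> \<one> \<otimes> [n] \<cdot> \<one>"
  using add_pow_ldistr[of \<one> "[n] \<cdot> \<one>" m] add.nat_pow_pow[of \<one> m n]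
  by (simp add: mult.commute)

context group_ring_context
begin

sublocale RG: ring RG
  by (rule ring_RG)

lemma minus_coeff:
  assumes "f \<in> carrier RG" "x \<in> carrier G" shows "(\<ominus>\<^bsub>RG\<^esub> f) x = \<ominus>\<^bsub>R\<^esub> f x"
proof -
  have "(\<ominus>\<^bsub>RG\<^esub> f \<oplus>\<^bsub>RG\<^esub> f) x = \<zero>\<^bsub>R\<^esub>"
    using assms by (simp add: RG.l_neg zero_coeff)
  then have "(\<ominus>\<^bsub>RG\<^esub> f) x \<oplus>\<^bsub>R\<^esub> f x = \<zero>\<^bsub>R\<^esub>"
    using assms by (simp add: add_coeff)
  moreover have "(\<ominus>\<^bsub>RG\<^esub> f) x \<in> carrier R" using coeff_closed[of "\<ominus>\<^bsub>RG\<^esub> f" x] assms by simp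
  ultimately show ?thesis using assms R.minus_equality by simp
qed

lemma diff_coeff:
  "f \<in> carrier RG \<Longrightarrow> h \<in> carrier RG \<Longrightarrow> x \<in> carrier G \<Longrightarrow> (f \<ominus>\<^bsub>RG\<^esub> h) x = f x \<ominus>\<^bsub>R\<^esub> h x"
  by (simp add: RG.minus_eq R.minus_eq add_coeff minus_coeff)

lemma finsum_coeff:
  assumes "finite A" "\<And>a. a \<in> A \<Longrightarrow> F a \<in> carrier RG" "x \<in> carrier G"
  shows "(\<Oplus>\<^bsub>RG\<^esub>a\<in>A. F a) x = (\<Oplus>\<^bsub>R\<^esub>a\<in>A. F a x)"
  using assms(1,2)
proof (induction A rule: finite_induct)
  case empty
  show ?case using assms(3) by (simp add: zero_coeff)
next
  case (insert b A)
  have F: "F \<in> A \<rightarrow> carrier RG" "F b \<in> carrier RG" using insert.prems by auto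
  have Fx: "(\<lambda>a. F a x) \<in> A \<rightarrow> carrier R" "F b x \<in> carrier R"
    using insert.prems assms(3) by auto
  show ?case
    unfolding RG.finsum_insert[OF insert.hyps F] R.finsum_insert[OF insert.hyps Fx]
    using insert assms(3) by (simp add: add_coeff)
qed

section \<open>The augmentation map and its kernel\<close>

definition augmentation :: "('c \<Rightarrow> 'a) \<Rightarrow> 'a" where
  "augmentation f = (\<Oplus>\<^bsub>R\<^esub>x\<in>supp f. f x)"

lemma augmentation_superset:
  assumes "f \<in> carrier RG" "finite A" "supp f \<subseteq> A" "A \<subseteq> carrier G"
  shows "augmentation f = (\<Oplus>\<^bsub>R\<^esub>x\<in>A. f x)"
  unfolding augmentation_def
proof (rule R.finsum_eq_superset[OF assms(2,3)])
  show "f i = \<zero>\<^bsub>R\<^esub>" if "i \<in> A - supp f" for i using that assms(4) notin_supp[of i f] by auto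
  show "f \<in> A \<rightarrow> carrier R" using assms(1,4) by auto
qed

lemma augmentation_closed: "f \<in> carrier RG \<Longrightarrow> augmentation f \<in> carrier R"
  unfolding augmentation_def using subsetD[OF supp_subset] by (intro R.finsum_closed) auto

lemma augmentation_monomial:
  assumes "r \<in> carrier R" "g \<in> carrier G" shows "augmentation (monomial r g) = r"
  using assms supp_monomial by (subst augmentation_superset[of _ "{g}"]) (auto simp: monomial_coeff)

lemma augmentation_add:
  assumes f: "f \<in> carrier RG" and h: "h \<in> carrier RG"
  shows "augmentation (f \<oplus>\<^bsub>RG\<^esub> h) = augmentation f \<oplus>\<^bsub>R\<^esub> augmentation h"
proof -
  let ?A = "supp f \<union> supp h"
  have A: "finite ?A" "?A \<subseteq> carrier G" using f h supp_subset by auto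
  have AG: "\<And>a. a \<in> ?A \<Longrightarrow> a \<in> carrier G" using A(2) by (rule subsetD)
  have "supp (f \<oplus>\<^bsub>RG\<^esub> h) \<subseteq> ?A"
  proof
    fix x assume x: "x \<in> supp (f \<oplus>\<^bsub>RG\<^esub> h)"
    then have xG: "x \<in> carrier G" and ne: "(f \<oplus>\<^bsub>RG\<^esub> h) x \<noteq> \<zero>\<^bsub>R\<^esub>"
      by (simp_all add: coeff_support_def)
    show "x \<in> ?A"
    proof (rule ccontr)
      assume "x \<notin> ?A"
      then have "f x = \<zero>\<^bsub>R\<^esub>" "h x = \<zero>\<^bsub>R\<^esub>" using notin_supp[OF xG] by auto
      then show False using ne by (simp add: add_coeff[OF xG])
    qed
  qed
  then have "augmentation (f \<oplus>\<^bsub>RG\<^esub> h) = (\<Oplus>\<^bsub>R\<^esub>x\<in>?A. (f \<oplus>\<^bsub>RG\<^esub> h) x)"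
    using A f h by (intro augmentation_superset) auto
  also have "\<dots> = (\<Oplus>\<^bsub>R\<^esub>x\<in>?A. f x \<oplus>\<^bsub>R\<^esub> h x)"
    using AG f h by (intro R.add.finprod_cong') (auto simp: add_coeff)
  also have "\<dots> = (\<Oplus>\<^bsub>R\<^esub>x\<in>?A. f x) \<oplus>\<^bsub>R\<^esub> (\<Oplus>\<^bsub>R\<^esub>x\<in>?A. h x)"
    using AG f h by (intro R.add.finprod_multf) auto
  also have "\<dots> = augmentation f \<oplus>\<^bsub>R\<^esub> augmentation h"
    using augmentation_superset[OF f A(1) _ A(2)] augmentation_superset[OF h A(1) _ A(2)] by simp
  finally show ?thesis .
qed

text \<open>\<open>C\<close> is the set of products of support elements. For each fixed a in the
  support of \<open>f\<close>, the translate of \<open>C\<close> by the inverse of a contains the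
  support of \<open>h\<close>, so the inner sum is the augmentation of \<open>h\<close> whatever a
  is.\<close>

lemma augmentation_mult:
  assumes f: "f \<in> carrier RG" and h: "h \<in> carrier RG"
  shows "augmentation (f \<otimes>\<^bsub>RG\<^esub> h) = augmentation f \<otimes>\<^bsub>R\<^esub> augmentation h"
proof -
  define C where "C = (\<lambda>(a, b). a \<otimes>\<^bsub>G\<^esub> b) ` (supp f \<times> supp h)"
  have S: "\<And>a. a \<in> supp f \<Longrightarrow> a \<in> carrier G" "\<And>b. b \<in> supp h \<Longrightarrow> b \<in> carrier G"
    using subsetD[OF supp_subset] by auto
  have C: "finite C" "C \<subseteq> carrier G" using f h S by (auto simp: C_def)
  have CG: "\<And>c. c \<in> C \<Longrightarrow> c \<in> carrier G" using C(2) by (rule subsetD)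
  have "supp (f \<otimes>\<^bsub>RG\<^esub> h) \<subseteq> C"
    using mult_support[OF f h] by (auto simp: C_def coeff_support_def[of R G "f \<otimes>\<^bsub>RG\<^esub> h"])
  then have "augmentation (f \<otimes>\<^bsub>RG\<^esub> h) = (\<Oplus>\<^bsub>R\<^esub>x\<in>C. (f \<otimes>\<^bsub>RG\<^esub> h) x)"
    using C f h by (intro augmentation_superset) auto
  also have "\<dots> = (\<Oplus>\<^bsub>R\<^esub>x\<in>C. \<Oplus>\<^bsub>R\<^esub>a\<in>supp f. f a \<otimes>\<^bsub>R\<^esub> h (inv\<^bsub>G\<^esub> a \<otimes>\<^bsub>G\<^esub> x))"
    using mult_coeff_left[OF f h _ finite_supp[OF f] order_refl supp_subset] CG S f h
    by (intro R.add.finprod_cong') (auto intro!: R.finsum_closed)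
  also have "\<dots> = (\<Oplus>\<^bsub>R\<^esub>a\<in>supp f. \<Oplus>\<^bsub>R\<^esub>x\<in>C. f a \<otimes>\<^bsub>R\<^esub> h (inv\<^bsub>G\<^esub> a \<otimes>\<^bsub>G\<^esub> x))"
    using C CG S f h by (intro R.finsum_swap) auto
  also have "\<dots> = (\<Oplus>\<^bsub>R\<^esub>a\<in>supp f. f a \<otimes>\<^bsub>R\<^esub> augmentation h)"
  proof (rule R.add.finprod_cong')
    fix a assume a: "a \<in> supp f"
    let ?t = "\<lambda>x. inv\<^bsub>G\<^esub> a \<otimes>\<^bsub>G\<^esub> x"
    have aG: "a \<in> carrier G" using S a by simp
    have inj: "inj_on ?t C" using CG aG
      by (intro inj_on_inverseI[of _ "\<lambda>y. a \<otimes>\<^bsub>G\<^esub> y"]) (simp flip: G.m_assoc)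
    have sub: "supp h \<subseteq> ?t ` C"
    proof
      fix b assume b: "b \<in> supp h"
      have "b = ?t (a \<otimes>\<^bsub>G\<^esub> b)" using aG S(2)[OF b] by (simp flip: G.m_assoc)
      moreover have "a \<otimes>\<^bsub>G\<^esub> b \<in> C" using a b by (auto simp: C_def)
      ultimately show "b \<in> ?t ` C" by (rule image_eqI)
    qed
    have tC: "?t ` C \<subseteq> carrier G" using CG aG by auto
    have "augmentation h = (\<Oplus>\<^bsub>R\<^esub>y\<in>?t ` C. h y)"
      using C(1) sub tC h by (intro augmentation_superset) auto
    also have "\<dots> = (\<Oplus>\<^bsub>R\<^esub>x\<in>C. h (?t x))"
      using inj tC h by (intro R.add.finprod_reindex) auto
    finally have aug: "augmentation h = (\<Oplus>\<^bsub>R\<^esub>x\<in>C. h (?t x))" .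
    show "(\<Oplus>\<^bsub>R\<^esub>x\<in>C. f a \<otimes>\<^bsub>R\<^esub> h (?t x)) = f a \<otimes>\<^bsub>R\<^esub> augmentation h"
      unfolding aug using C(1) CG aG f h by (intro R.finsum_rdistr[symmetric]) auto
  qed (use S f h augmentation_closed[OF h] in auto)
  also have "\<dots> = augmentation f \<otimes>\<^bsub>R\<^esub> augmentation h"
    unfolding augmentation_def[of f]
    using f h S augmentation_closed[OF h] by (intro R.finsum_ldistr[symmetric]) auto
  finally show ?thesis .
qed

lemma augmentation_hom: "ring_hom_ring RG R augmentation"
  by (intro ring_hom_ringI RG.ring_axioms R.ring_axioms)
    (simp_all add: augmentation_closed augmentation_mult augmentation_add one_eq_monomial augmentation_monomial)

lemma monomial_mult:
  assumes "r \<in> carrier R" "s \<in> carrier R" "g \<in> carrier G" "h \<in> carrier G"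
  shows "monomial r g \<otimes>\<^bsub>RG\<^esub> monomial s h = monomial (r \<otimes>\<^bsub>R\<^esub> s) (g \<otimes>\<^bsub>G\<^esub> h)"
proof (rule RG_ext)
  fix x assume x: "x \<in> carrier G"
  have "inv\<^bsub>G\<^esub> g \<otimes>\<^bsub>G\<^esub> x = h \<longleftrightarrow> x = g \<otimes>\<^bsub>G\<^esub> h"
    using assms x G.inv_solve_left'[of h g x] by auto
  then show "(monomial r g \<otimes>\<^bsub>RG\<^esub> monomial s h) x = monomial (r \<otimes>\<^bsub>R\<^esub> s) (g \<otimes>\<^bsub>G\<^esub> h) x"
    using assms x by (simp add: monomial_mult_coeff monomial_coeff)
qed (use assms in simp_all)

abbreviation scalar where "scalar r \<equiv> monomial r \<one>\<^bsub>G\<^esub>"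
abbreviation unit_of where "unit_of g \<equiv> monomial \<one>\<^bsub>R\<^esub> g"

lemma scalar_hom: "ring_hom_ring R RG scalar"
proof (intro ring_hom_ringI RG.ring_axioms R.ring_axioms)
  fix r s assume rs: "r \<in> carrier R" "s \<in> carrier R"
  show "scalar (r \<oplus>\<^bsub>R\<^esub> s) = scalar r \<oplus>\<^bsub>RG\<^esub> scalar s"
    using rs by (intro RG_ext) (auto simp: add_coeff monomial_coeff)
qed (simp_all add: monomial_mult one_eq_monomial)

text \<open>The right side is the formal sum for \<open>f\<close> minus its augmentation times 1,
  and the augmentation vanishes. The index set \<open>A\<close> is left free so that it can later be
  a whole finite subgroup.\<close>

lemma augmentation_zero_decomposition:
  assumes f: "f \<in> carrier RG" and aug: "augmentation f = \<zero>\<^bsub>R\<^esub>"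
    and A: "finite A" "supp f \<subseteq> A" "A \<subseteq> carrier G"
  shows "f = (\<Oplus>\<^bsub>RG\<^esub>h\<in>A. scalar (f h) \<otimes>\<^bsub>RG\<^esub> (unit_of h \<ominus>\<^bsub>RG\<^esub> \<one>\<^bsub>RG\<^esub>))"
proof (rule RG_ext)
  have AG: "\<And>h. h \<in> A \<Longrightarrow> h \<in> carrier G" using A(3) by (rule subsetD)
  have terms: "scalar (f h) \<otimes>\<^bsub>RG\<^esub> (unit_of h \<ominus>\<^bsub>RG\<^esub> \<one>\<^bsub>RG\<^esub>) \<in> carrier RG" if "h \<in> A" for h
    using AG[OF that] f by simp
  show "(\<Oplus>\<^bsub>RG\<^esub>h\<in>A. scalar (f h) \<otimes>\<^bsub>RG\<^esub> (unit_of h \<ominus>\<^bsub>RG\<^esub> \<one>\<^bsub>RG\<^esub>)) \<in> carrier RG"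
    using terms by (intro RG.finsum_closed) auto
  fix x assume x: "x \<in> carrier G"
  \<comment> \<open>\<open>e\<close> is the coefficient at \<open>x\<close> of -1. It is common to
    all terms, so it factors out of the sum and meets the augmentation.\<close>
  define e where "e = \<ominus>\<^bsub>R\<^esub> \<one>\<^bsub>RG\<^esub> x"
  have e: "e \<in> carrier R" using x by (simp add: e_def)
  have "(\<Oplus>\<^bsub>RG\<^esub>h\<in>A. scalar (f h) \<otimes>\<^bsub>RG\<^esub> (unit_of h \<ominus>\<^bsub>RG\<^esub> \<one>\<^bsub>RG\<^esub>)) x
      = (\<Oplus>\<^bsub>R\<^esub>h\<in>A. (scalar (f h) \<otimes>\<^bsub>RG\<^esub> (unit_of h \<ominus>\<^bsub>RG\<^esub> \<one>\<^bsub>RG\<^esub>)) x)"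
    using A(1) terms x by (rule finsum_coeff)
  also have "\<dots> = (\<Oplus>\<^bsub>R\<^esub>h\<in>A. (if x = h then f h else \<zero>\<^bsub>R\<^esub>) \<oplus>\<^bsub>R\<^esub> f h \<otimes>\<^bsub>R\<^esub> e)"
  proof (rule R.add.finprod_cong')
    fix h assume h: "h \<in> A"
    have "(scalar (f h) \<otimes>\<^bsub>RG\<^esub> (unit_of h \<ominus>\<^bsub>RG\<^esub> \<one>\<^bsub>RG\<^esub>)) x
        = f h \<otimes>\<^bsub>R\<^esub> (unit_of h \<ominus>\<^bsub>RG\<^esub> \<one>\<^bsub>RG\<^esub>) x"
      using AG[OF h] f x monomial_mult_coeff[of "f h" "\<one>\<^bsub>G\<^esub>" "unit_of h \<ominus>\<^bsub>RG\<^esub> \<one>\<^bsub>RG\<^esub>" x] by simp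
    also have "(unit_of h \<ominus>\<^bsub>RG\<^esub> \<one>\<^bsub>RG\<^esub>) x = unit_of h x \<oplus>\<^bsub>R\<^esub> e"
      using AG[OF h] x by (simp add: diff_coeff R.minus_eq e_def)
    also have "f h \<otimes>\<^bsub>R\<^esub> (unit_of h x \<oplus>\<^bsub>R\<^esub> e) = f h \<otimes>\<^bsub>R\<^esub> unit_of h x \<oplus>\<^bsub>R\<^esub> f h \<otimes>\<^bsub>R\<^esub> e"
      using AG[OF h] x f e by (simp add: R.r_distr)
    also have "f h \<otimes>\<^bsub>R\<^esub> unit_of h x = (if x = h then f h else \<zero>\<^bsub>R\<^esub>)"
      using AG[OF h] x f by (simp add: monomial_coeff)
    finally show "(scalar (f h) \<otimes>\<^bsub>RG\<^esub> (unit_of h \<ominus>\<^bsub>RG\<^esub> \<one>\<^bsub>RG\<^esub>)) x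
        = (if x = h then f h else \<zero>\<^bsub>R\<^esub>) \<oplus>\<^bsub>R\<^esub> f h \<otimes>\<^bsub>R\<^esub> e" .
  qed (use AG f e in auto)
  also have "\<dots> = (\<Oplus>\<^bsub>R\<^esub>h\<in>A. if x = h then f h else \<zero>\<^bsub>R\<^esub>) \<oplus>\<^bsub>R\<^esub> (\<Oplus>\<^bsub>R\<^esub>h\<in>A. f h \<otimes>\<^bsub>R\<^esub> e)"
    using AG f e by (intro R.add.finprod_multf) auto
  also have "(\<Oplus>\<^bsub>R\<^esub>h\<in>A. f h \<otimes>\<^bsub>R\<^esub> e) = (\<Oplus>\<^bsub>R\<^esub>h\<in>A. f h) \<otimes>\<^bsub>R\<^esub> e"
    using AG f e A(1) by (intro R.finsum_ldistr[symmetric]) auto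
  also have "(\<Oplus>\<^bsub>R\<^esub>h\<in>A. f h) = \<zero>\<^bsub>R\<^esub>" using augmentation_superset[OF f A] aug by simp
  also have "(\<Oplus>\<^bsub>R\<^esub>h\<in>A. if x = h then f h else \<zero>\<^bsub>R\<^esub>) = f x"
  proof (cases "x \<in> A")
    case True
    then show ?thesis using AG f A(1) by (intro R.add.finprod_singleton) auto
  next
    case False
    then have "f x = \<zero>\<^bsub>R\<^esub>" using A(2) x notin_supp[of x f] by auto
    then show ?thesis using False by (simp, intro R.add.finprod_one_eqI) auto
  qed
  finally show "f x = (\<Oplus>\<^bsub>RG\<^esub>h\<in>A. scalar (f h) \<otimes>\<^bsub>RG\<^esub> (unit_of h \<ominus>\<^bsub>RG\<^esub> \<one>\<^bsub>RG\<^esub>)) x"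
    using x f e by simp
qed (rule f)

text \<open>The k-th power of p times 1 is p^k times 1, so nilpotence of p gives the ring an
  additive exponent that is a power of p.\<close>

lemma nilpotent_char:
  assumes "[p] \<cdot>\<^bsub>R\<^esub> \<one>\<^bsub>R\<^esub> \<in> nilpotents R"
  shows "\<exists>k. [(p ^ k :: nat)] \<cdot>\<^bsub>RG\<^esub> \<one>\<^bsub>RG\<^esub> = \<zero>\<^bsub>RG\<^esub>"
proof -
  interpret scalar: ring_hom_ring R RG scalar by (rule scalar_hom)
  obtain k :: nat where k: "([p] \<cdot>\<^bsub>R\<^esub> \<one>\<^bsub>R\<^esub>) [^]\<^bsub>R\<^esub> k = \<zero>\<^bsub>R\<^esub>"
    using assms by (auto simp: nilpotents_def)
  have "([p] \<cdot>\<^bsub>R\<^esub> \<one>\<^bsub>R\<^esub>) [^]\<^bsub>R\<^esub> j = [(p ^ j)] \<cdot>\<^bsub>R\<^esub> \<one>\<^bsub>R\<^esub>" for j :: nat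
  proof (induction j)
    case (Suc j)
    then show ?case using R.add_pow_one_mult[of "p ^ j" p] by (simp add: mult.commute)
  qed simp
  then have zero: "[(p ^ k)] \<cdot>\<^bsub>R\<^esub> \<one>\<^bsub>R\<^esub> = \<zero>\<^bsub>R\<^esub>" using k by simp
  have "[n] \<cdot>\<^bsub>RG\<^esub> \<one>\<^bsub>RG\<^esub> = scalar ([n] \<cdot>\<^bsub>R\<^esub> \<one>\<^bsub>R\<^esub>)" for n :: nat
    by (induction n) simp_all
  then have "[(p ^ k)] \<cdot>\<^bsub>RG\<^esub> \<one>\<^bsub>RG\<^esub> = \<zero>\<^bsub>RG\<^esub>" using zero by simp
  then show ?thesis ..
qed

text \<open>Only the subgroup generated by the finite support matters, and local finiteness makes it
  a finite p-group. Scalars sit at the identity of \<open>G\<close>, so they commute with group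
  elements although \<open>R\<close> may be noncommutative.\<close>

lemma augmentation_kernel_nil:
  assumes p: "Factorial_Ring.prime p" and lf: "locally_finite G" and pG: "p_group p G"
    and nil: "[p] \<cdot>\<^bsub>R\<^esub> \<one>\<^bsub>R\<^esub> \<in> nilpotents R"
    and f: "f \<in> carrier RG" "augmentation f = \<zero>\<^bsub>R\<^esub>"
  shows "f \<in> nilpotents RG"
proof -
  define H where "H = generate G (supp f)"
  define GH where "GH = G\<lparr>carrier := H\<rparr>"
  have sub: "subgroup H G" unfolding H_def by (rule G.generate_is_subgroup[OF supp_subset])
  have HG: "H \<subseteq> carrier G" using sub by (rule subgroup.subset)
  have fin: "finite H" using lf finite_supp[OF f(1)] supp_subset by (simp add: locally_finite_def H_def)
  have supp_H: "supp f \<subseteq> H" unfolding H_def by (auto intro: generate.incl)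
  have GH_simps: "carrier GH = H" "mult GH = mult G" "one GH = one G" by (simp_all add: GH_def)
  interpret GH: group GH unfolding GH_def using G.subgroup_imp_group[OF sub] .
  have "GH.ord x = G.ord x" if x: "x \<in> H" for x
  proof -
    have "x [^]\<^bsub>GH\<^esub> n = x [^]\<^bsub>G\<^esub> n" for n :: nat
      unfolding GH_def by (simp flip: G.nat_pow_consistent)
    then show ?thesis unfolding GH.ord_def G.ord_def by (simp add: GH_simps)
  qed
  then have pGH: "p_group p GH"
    using pG HG by (auto simp: p_group_def GH_simps)
  obtain k where k: "[(p ^ k :: nat)] \<cdot>\<^bsub>RG\<^esub> \<one>\<^bsub>RG\<^esub> = \<zero>\<^bsub>RG\<^esub>" using nilpotent_char[OF nil] ..
  interpret A: finite_p_group_in_ring RG GH unit_of p k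
  proof (intro finite_p_group_in_ring.intro finite_p_group_in_ring_axioms.intro
      RG.ring_axioms GH.is_group p pGH k)
    show "finite (carrier GH)" using fin by (simp add: GH_simps)
    show "unit_of h \<in> carrier RG" for h by simp
    show "unit_of \<one>\<^bsub>GH\<^esub> = \<one>\<^bsub>RG\<^esub>" by (simp add: GH_simps one_eq_monomial)
    show "unit_of (g \<otimes>\<^bsub>GH\<^esub> h) = unit_of g \<otimes>\<^bsub>RG\<^esub> unit_of h"
      if "g \<in> carrier GH" "h \<in> carrier GH" for g h
    proof -
      have "g \<in> carrier G" "h \<in> carrier G" using that HG by (auto simp: GH_simps)
      then show ?thesis by (simp add: GH_simps monomial_mult)
    qed
  qed
  have "(\<Oplus>\<^bsub>RG\<^esub>h\<in>carrier GH. scalar (f h) \<otimes>\<^bsub>RG\<^esub> (unit_of h \<ominus>\<^bsub>RG\<^esub> \<one>\<^bsub>RG\<^esub>)) \<in> nilpotents RG"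
  proof (rule A.augmentation_nilpotent)
    show "scalar (f h) \<in> carrier RG" if "h \<in> carrier GH" for h
      using that HG f(1) by (auto simp: GH_simps)
    show "scalar (f g) \<otimes>\<^bsub>RG\<^esub> unit_of h = unit_of h \<otimes>\<^bsub>RG\<^esub> scalar (f g)"
      if "g \<in> carrier GH" "h \<in> carrier GH" for g h
    proof -
      have "g \<in> carrier G" "h \<in> carrier G" using that HG by (auto simp: GH_simps)
      then show ?thesis using f(1) by (simp add: monomial_mult)
    qed
  qed
  then show ?thesis
    using augmentation_zero_decomposition[OF f fin supp_H HG] by (simp add: GH_simps)
qed

lemma fine_by_group_ring:
  assumes "Factorial_Ring.prime p" "locally_finite G" "p_group p G" "[p] \<cdot>\<^bsub>R\<^esub> \<one>\<^bsub>R\<^esub> \<in> nilpotents R"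
    and fine: "fine_by T R" and T: "T \<subseteq> Units R" "\<one>\<^bsub>R\<^esub> \<in> T"
    and T': "T' \<subseteq> Units RG" "\<one>\<^bsub>RG\<^esub> \<in> T'" "scalar ` T \<subseteq> T'"
  shows "fine_by T' RG"
proof -
  interpret aug: ring_hom_ring RG R augmentation by (rule augmentation_hom)
  show ?thesis
  proof (rule aug.fine_by_lift[OF fine T T'(1,2) scalar_hom T'(3)])
    show "augmentation (scalar r) = r" if "r \<in> carrier R" for r
      using that by (simp add: augmentation_monomial)
    show "f \<in> nilpotents RG" if "f \<in> carrier RG" "augmentation f = \<zero>\<^bsub>R\<^esub>" for f
      using augmentation_kernel_nil[OF assms(1-4)] that .
  qed
qed

end

section \<open>Groups whose augmentation ideal lies in the radical\<close>

text \<open>By Bezout, m x = n y + 1, so 1 - x m = -y n has a left inverse because m is in the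
  radical. Hence c n = 1 for some c; if n were also in the radical, 1 - c n = 0 would have a left
  inverse.\<close>

lemma (in ring) coprime_notin_jacobson_radical:
  assumes ne: "\<one> \<noteq> \<zero>" and "m \<noteq> 0" and co: "coprime m n"
    and m: "[(m::nat)] \<cdot> \<one> \<in> jacobson_radical R"
  shows "[(n::nat)] \<cdot> \<one> \<notin> jacobson_radical R"
proof
  assume n: "[n] \<cdot> \<one> \<in> jacobson_radical R"
  obtain x y where xy: "m * x = n * y + 1"
    using bezout_nat[OF \<open>m \<noteq> 0\<close>, of n] co by auto
  obtain b where b: "b \<in> carrier R" "b \<otimes> (\<one> \<ominus> [x] \<cdot> \<one> \<otimes> [m] \<cdot> \<one>) = \<one>"
    using jacobson_radical_left_inverse[OF m, of "[x] \<cdot> \<one>"] by auto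
  define c where "c = b \<otimes> (\<ominus> ([y] \<cdot> \<one>))"
  have c: "c \<in> carrier R" using b by (simp add: c_def)
  have "[x] \<cdot> \<one> \<otimes> [m] \<cdot> \<one> = [(y * n + 1)] \<cdot> \<one>"
    using xy by (simp add: mult.commute flip: add_pow_one_mult)
  also have "\<dots> = [y] \<cdot> \<one> \<otimes> [n] \<cdot> \<one> \<oplus> \<one>"
    by (simp add: add_pow_one_mult)
  finally have "\<one> \<ominus> [x] \<cdot> \<one> \<otimes> [m] \<cdot> \<one> = (\<ominus> ([y] \<cdot> \<one>)) \<otimes> [n] \<cdot> \<one>"
    using a_lcomm[of \<one> "\<ominus> ([y] \<cdot> \<one> \<otimes> [n] \<cdot> \<one>)" "\<ominus> \<one>"]
    by (simp add: minus_eq minus_add l_minus r_neg)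
  then have cn: "c \<otimes> [n] \<cdot> \<one> = \<one>" using b by (simp add: c_def m_assoc)
  obtain d where "d \<in> carrier R" "d \<otimes> (\<one> \<ominus> c \<otimes> [n] \<cdot> \<one>) = \<one>"
    using jacobson_radical_left_inverse[OF n c] .
  then show False using ne by (simp add: cn minus_eq r_neg)
qed

context group_ring_context
begin

text \<open>These two assumptions are all that is extracted from the fineness of the group ring in
  order to determine the structure of \<open>G\<close>.\<close>

context
  assumes one_neq_zero: "\<one>\<^bsub>R\<^esub> \<noteq> \<zero>\<^bsub>R\<^esub>"
    and augmentation_kernel: "\<And>f. f \<in> carrier RG \<Longrightarrow> augmentation f = \<zero>\<^bsub>R\<^esub> \<Longrightarrow> f \<in> jacobson_radical RG"
begin

lemma one_minus_unit_of_augmentation: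
  assumes "g \<in> carrier G" shows "augmentation (\<one>\<^bsub>RG\<^esub> \<ominus>\<^bsub>RG\<^esub> unit_of g) = \<zero>\<^bsub>R\<^esub>"
proof -
  interpret aug: ring_hom_ring RG R augmentation by (rule augmentation_hom)
  show ?thesis using assms by (simp add: RG.minus_eq augmentation_monomial R.r_neg)
qed

text \<open>If \<open>g\<close> had infinite order, the Laurent polynomial \<open>1 - g + g\<^sup>2\<close> would be left invertible, but
  its extreme coefficients are units at different exponents.\<close>

lemma ord_neq_zero:
  assumes g: "g \<in> carrier G"
  shows "G.ord g \<noteq> 0"
proof
  assume ord: "G.ord g = 0"
  let ?w = "\<one>\<^bsub>RG\<^esub> \<ominus>\<^bsub>RG\<^esub> unit_of g"
  have w: "?w \<in> jacobson_radical RG"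
    using one_minus_unit_of_augmentation[OF g] by (intro augmentation_kernel) simp_all
  \<comment> \<open>With the multiplier g, the left invertible element is 1 - g (1 - g) = 1 - g +
    g^2.\<close>
  obtain y where y: "y \<in> carrier RG" "y \<otimes>\<^bsub>RG\<^esub> (\<one>\<^bsub>RG\<^esub> \<ominus>\<^bsub>RG\<^esub> unit_of g \<otimes>\<^bsub>RG\<^esub> ?w) = \<one>\<^bsub>RG\<^esub>"
    using RG.jacobson_radical_left_inverse[OF w, of "unit_of g"] by auto
  have "\<one>\<^bsub>RG\<^esub> \<ominus>\<^bsub>RG\<^esub> unit_of g \<otimes>\<^bsub>RG\<^esub> ?w = \<one>\<^bsub>RG\<^esub> \<ominus>\<^bsub>RG\<^esub> unit_of g \<oplus>\<^bsub>RG\<^esub> unit_of g \<otimes>\<^bsub>RG\<^esub> unit_of g"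
    by (simp add: RG.minus_eq RG.r_distr RG.r_minus RG.minus_add RG.a_assoc)
  then have "y \<ominus>\<^bsub>RG\<^esub> y \<otimes>\<^bsub>RG\<^esub> unit_of g \<oplus>\<^bsub>RG\<^esub> y \<otimes>\<^bsub>RG\<^esub> unit_of g \<otimes>\<^bsub>RG\<^esub> unit_of g = \<one>\<^bsub>RG\<^esub>"
    using y by (simp add: RG.minus_eq RG.r_distr RG.r_minus RG.m_assoc)
  then have coeffs: "y x \<ominus>\<^bsub>R\<^esub> y (x \<otimes>\<^bsub>G\<^esub> inv\<^bsub>G\<^esub> g) \<oplus>\<^bsub>R\<^esub> y (x \<otimes>\<^bsub>G\<^esub> inv\<^bsub>G\<^esub> g \<otimes>\<^bsub>G\<^esub> inv\<^bsub>G\<^esub> g) = \<one>\<^bsub>RG\<^esub> x"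
    if "x \<in> carrier G" for x
    using that g y(1)
    by (auto simp: add_coeff diff_coeff mult_monomial_coeff dest!: arg_cong[where f = "\<lambda>f. f x"])
  \<comment> \<open>Restricting \<open>y\<close> to the powers of \<open>g\<close>, which are
    distinct, turns the identity into a recurrence for a finitely supported sequence indexed by the
    integers.\<close>
  define a where "a = (\<lambda>n::int. y (g [^]\<^bsub>G\<^esub> n))"
  have aR: "a n \<in> carrier R" for n using g y(1) by (simp add: a_def)
  have inj: "g [^]\<^bsub>G\<^esub> m = g [^]\<^bsub>G\<^esub> n \<longleftrightarrow> m = n" for m n :: int
    using G.int_pow_eq[OF g, of m n] ord by auto
  have shift: "g [^]\<^bsub>G\<^esub> n \<otimes>\<^bsub>G\<^esub> inv\<^bsub>G\<^esub> g = g [^]\<^bsub>G\<^esub> (n - 1)" for n :: int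
    using G.int_pow_diff[OF g, of n 1] g by simp
  have rec: "a n \<ominus>\<^bsub>R\<^esub> a (n - 1) \<oplus>\<^bsub>R\<^esub> a (n - 2) = (if n = 0 then \<one>\<^bsub>R\<^esub> else \<zero>\<^bsub>R\<^esub>)" for n
    using coeffs[of "g [^]\<^bsub>G\<^esub> n"] g inj[of n 0]
    by (simp add: shift a_def one_coeff)
  define T where "T = {n. a n \<noteq> \<zero>\<^bsub>R\<^esub>}"
  have "(\<lambda>n. g [^]\<^bsub>G\<^esub> n) ` T \<subseteq> supp y"
    using g by (auto simp: T_def a_def coeff_support_def)
  then have "finite ((\<lambda>n. g [^]\<^bsub>G\<^esub> n) ` T)" using finite_supp[OF y(1)] by (rule finite_subset)
  moreover have "inj_on (\<lambda>n. g [^]\<^bsub>G\<^esub> n) T" using inj by (simp add: inj_on_def)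
  ultimately have fin: "finite T" by (rule finite_imageD)
  have "T \<noteq> {}"
  proof
    assume "T = {}"
    then have "a n = \<zero>\<^bsub>R\<^esub>" for n by (auto simp: T_def)
    then show False using rec[of 0] one_neq_zero by (simp add: R.minus_eq)
  qed
  then have mem: "Min T \<in> T" "Max T \<in> T" "Min T \<le> Max T" using fin by auto
  \<comment> \<open>At index Max T + 2 only the last term of the recurrence survives, and at Min T
    only the first. Both are non-zero, so each index must be 0: this forces Max T = -2 and Min T =
    0, against Min T being at most Max T.\<close>
  have "a (Max T + 1) = \<zero>\<^bsub>R\<^esub>" "a (Max T + 2) = \<zero>\<^bsub>R\<^esub>"
    using Max_ge[OF fin, of "Max T + 1"] Max_ge[OF fin, of "Max T + 2"] by (auto simp: T_def)
  then have "a (Max T) = (if Max T + 2 = 0 then \<one>\<^bsub>R\<^esub> else \<zero>\<^bsub>R\<^esub>)"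
    using rec[of "Max T + 2"] aR by (simp add: R.minus_eq algebra_simps)
  then have "Max T = - 2" using mem(2) by (auto simp: T_def split: if_splits)
  moreover have "a (Min T - 1) = \<zero>\<^bsub>R\<^esub>" "a (Min T - 2) = \<zero>\<^bsub>R\<^esub>"
    using Min_le[OF fin, of "Min T - 1"] Min_le[OF fin, of "Min T - 2"] by (auto simp: T_def)
  then have "a (Min T) = (if Min T = 0 then \<one>\<^bsub>R\<^esub> else \<zero>\<^bsub>R\<^esub>)"
    using rec[of "Min T"] aR by (simp add: R.minus_eq)
  then have "Min T = 0" using mem(1) by (auto simp: T_def split: if_splits)
  ultimately show False using mem(3) by simp
qed

text \<open>With \<open>s\<close> the sum of the elements of the cyclic group generated by \<open>g\<close>, of order \<open>n\<close>, the element
  \<open>n - s\<close> has augmentation zero, and \<open>s (1 - g) = 0\<close>. So if \<open>y (1 - r (n - s)) = 1\<close>, then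
  \<open>y (1 - r n) (1 - g) = 1 - g\<close>; compare the coefficients at the identity.\<close>

lemma ord_in_jacobson_radical:
  assumes g: "g \<in> carrier G" and ne: "g \<noteq> \<one>\<^bsub>G\<^esub>"
  shows "[(G.ord g)] \<cdot>\<^bsub>R\<^esub> \<one>\<^bsub>R\<^esub> \<in> jacobson_radical R"
proof (rule R.jacobson_radicalI)
  interpret aug: ring_hom_ring RG R augmentation by (rule augmentation_hom)
  interpret scalar: ring_hom_ring R RG scalar by (rule scalar_hom)
  define C where "C = generate G {g}"
  define n where "n = [(G.ord g)] \<cdot>\<^bsub>R\<^esub> \<one>\<^bsub>R\<^esub>"
  have n: "n \<in> carrier R" by (simp add: n_def)
  have sub: "subgroup C G" unfolding C_def using g by (intro G.generate_is_subgroup) simp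
  have card: "card C = G.ord g" unfolding C_def using G.generate_pow_card[OF g] by simp
  then have fin: "finite C" using ord_neq_zero[OF g] by (metis card.infinite)
  have CG: "C \<subseteq> carrier G" using sub by (rule subgroup.subset)
  have gC: "g \<in> C" unfolding C_def by (rule generate.incl) simp
  define s where "s = (\<lambda>x\<in>carrier G. if x \<in> C then \<one>\<^bsub>R\<^esub> else \<zero>\<^bsub>R\<^esub>)"
  have s_coeff: "s x = (if x \<in> C then \<one>\<^bsub>R\<^esub> else \<zero>\<^bsub>R\<^esub>)" if "x \<in> carrier G" for x
    using that by (simp add: s_def)
  have s: "s \<in> carrier RG"
    by (rule RG_I[OF fin]) (auto simp: s_def)
  have sg: "s \<otimes>\<^bsub>RG\<^esub> unit_of g = s"
  proof (rule RG_ext)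
    fix x assume x: "x \<in> carrier G"
    have "x \<otimes>\<^bsub>G\<^esub> inv\<^bsub>G\<^esub> g \<in> C \<longleftrightarrow> x \<in> C"
    proof
      assume "x \<otimes>\<^bsub>G\<^esub> inv\<^bsub>G\<^esub> g \<in> C"
      then have "x \<otimes>\<^bsub>G\<^esub> inv\<^bsub>G\<^esub> g \<otimes>\<^bsub>G\<^esub> g \<in> C" using gC by (rule subgroup.m_closed[OF sub])
      then show "x \<in> C" using x g by (simp add: G.m_assoc)
    next
      assume "x \<in> C"
      then show "x \<otimes>\<^bsub>G\<^esub> inv\<^bsub>G\<^esub> g \<in> C"
        using subgroup.m_inv_closed[OF sub gC] by (rule subgroup.m_closed[OF sub])
    qed
    then show "(s \<otimes>\<^bsub>RG\<^esub> unit_of g) x = s x"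
      using x g s s_coeff[of x] s_coeff[of "x \<otimes>\<^bsub>G\<^esub> inv\<^bsub>G\<^esub> g"] by (simp add: mult_monomial_coeff)
  qed (use s in simp_all)
  have "augmentation s = (\<Oplus>\<^bsub>R\<^esub>x\<in>C. s x)"
    using s fin CG by (intro augmentation_superset) (auto simp: coeff_support_def s_def)
  also have "\<dots> = (\<Oplus>\<^bsub>R\<^esub>x\<in>C. \<one>\<^bsub>R\<^esub>)"
    using CG s_coeff by (intro R.add.finprod_cong') auto
  also have "\<dots> = n" using R.add.finprod_const[of "\<one>\<^bsub>R\<^esub>" C] card by (simp add: n_def)
  finally have aug_s: "augmentation s = n" .
  define z where "z = scalar n \<ominus>\<^bsub>RG\<^esub> s"
  have z: "z \<in> carrier RG" using n s by (simp add: z_def)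
  have zJ: "z \<in> jacobson_radical RG"
    using z n s aug_s by (intro augmentation_kernel)
      (simp_all add: z_def RG.minus_eq augmentation_monomial R.r_neg)
  define w where "w = \<one>\<^bsub>RG\<^esub> \<ominus>\<^bsub>RG\<^esub> unit_of g"
  have w: "w \<in> carrier RG" by (simp add: w_def)
  have "s \<otimes>\<^bsub>RG\<^esub> w = \<zero>\<^bsub>RG\<^esub>"
    using s sg by (simp add: w_def RG.minus_eq RG.r_distr RG.r_minus RG.r_neg)
  then have zw: "z \<otimes>\<^bsub>RG\<^esub> w = scalar n \<otimes>\<^bsub>RG\<^esub> w"
    using s w n by (simp add: z_def RG.minus_eq RG.l_distr RG.l_minus)
  fix r assume r: "r \<in> carrier R"
  obtain y where y: "y \<in> carrier RG" "y \<otimes>\<^bsub>RG\<^esub> (\<one>\<^bsub>RG\<^esub> \<ominus>\<^bsub>RG\<^esub> scalar r \<otimes>\<^bsub>RG\<^esub> z) = \<one>\<^bsub>RG\<^esub>"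
    using RG.jacobson_radical_left_inverse[OF zJ, of "scalar r"] r by auto
  define t where "t = \<one>\<^bsub>R\<^esub> \<ominus>\<^bsub>R\<^esub> r \<otimes>\<^bsub>R\<^esub> n"
  have t: "t \<in> carrier R" using r n by (simp add: t_def)
  have "(\<one>\<^bsub>RG\<^esub> \<ominus>\<^bsub>RG\<^esub> scalar r \<otimes>\<^bsub>RG\<^esub> z) \<otimes>\<^bsub>RG\<^esub> w = w \<ominus>\<^bsub>RG\<^esub> scalar r \<otimes>\<^bsub>RG\<^esub> (scalar n \<otimes>\<^bsub>RG\<^esub> w)"
    using z w r zw by (simp add: RG.minus_eq RG.l_distr RG.l_minus RG.m_assoc)
  also have "\<dots> = (\<one>\<^bsub>RG\<^esub> \<ominus>\<^bsub>RG\<^esub> scalar r \<otimes>\<^bsub>RG\<^esub> scalar n) \<otimes>\<^bsub>RG\<^esub> w"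
    using w r n by (simp add: RG.minus_eq RG.l_distr RG.l_minus RG.m_assoc)
  also have "\<one>\<^bsub>RG\<^esub> \<ominus>\<^bsub>RG\<^esub> scalar r \<otimes>\<^bsub>RG\<^esub> scalar n = scalar t"
    using r n by (simp add: t_def R.minus_eq RG.minus_eq)
  also have "scalar t \<otimes>\<^bsub>RG\<^esub> w = scalar t \<ominus>\<^bsub>RG\<^esub> monomial t g"
    using t g by (simp add: w_def RG.minus_eq RG.r_distr RG.r_minus monomial_mult)
  finally have tw: "(\<one>\<^bsub>RG\<^esub> \<ominus>\<^bsub>RG\<^esub> scalar r \<otimes>\<^bsub>RG\<^esub> z) \<otimes>\<^bsub>RG\<^esub> w = scalar t \<ominus>\<^bsub>RG\<^esub> monomial t g" .
  have "y \<otimes>\<^bsub>RG\<^esub> (scalar t \<ominus>\<^bsub>RG\<^esub> monomial t g) = (y \<otimes>\<^bsub>RG\<^esub> (\<one>\<^bsub>RG\<^esub> \<ominus>\<^bsub>RG\<^esub> scalar r \<otimes>\<^bsub>RG\<^esub> z)) \<otimes>\<^bsub>RG\<^esub> w"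
    unfolding tw[symmetric] using y(1) z w r by (simp add: RG.m_assoc)
  also have "\<dots> = w" using y(2) w by simp
  finally have "y \<otimes>\<^bsub>RG\<^esub> scalar t \<ominus>\<^bsub>RG\<^esub> y \<otimes>\<^bsub>RG\<^esub> monomial t g = w"
    using y(1) t by (simp add: RG.minus_eq RG.r_distr RG.r_minus)
  then have "(y \<otimes>\<^bsub>RG\<^esub> scalar t \<ominus>\<^bsub>RG\<^esub> y \<otimes>\<^bsub>RG\<^esub> monomial t g) \<one>\<^bsub>G\<^esub> = w \<one>\<^bsub>G\<^esub>" by simp
  \<comment> \<open>As \<open>g\<close> is not the identity, the coefficient of \<open>w\<close>
    there is 1. On the left both terms carry the factor \<open>t\<close> on the right, so the
    difference of the two values of \<open>y\<close> is a left inverse of \<open>t\<close>.\<close>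
  then have "y \<one>\<^bsub>G\<^esub> \<otimes>\<^bsub>R\<^esub> t \<ominus>\<^bsub>R\<^esub> y (inv\<^bsub>G\<^esub> g) \<otimes>\<^bsub>R\<^esub> t = \<one>\<^bsub>R\<^esub>"
    using y(1) t g ne by (simp add: diff_coeff mult_monomial_coeff w_def one_coeff monomial_coeff R.minus_eq)
  then have "(y \<one>\<^bsub>G\<^esub> \<ominus>\<^bsub>R\<^esub> y (inv\<^bsub>G\<^esub> g)) \<otimes>\<^bsub>R\<^esub> t = \<one>\<^bsub>R\<^esub>"
    using y(1) t g by (simp add: R.minus_eq R.l_distr R.l_minus)
  moreover have "y \<one>\<^bsub>G\<^esub> \<ominus>\<^bsub>R\<^esub> y (inv\<^bsub>G\<^esub> g) \<in> carrier R" using y(1) g by simp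
  ultimately show "\<exists>y\<in>carrier R. y \<otimes>\<^bsub>R\<^esub> (\<one>\<^bsub>R\<^esub> \<ominus>\<^bsub>R\<^esub> r \<otimes>\<^bsub>R\<^esub> [(G.ord g)] \<cdot>\<^bsub>R\<^esub> \<one>\<^bsub>R\<^esub>) = \<one>\<^bsub>R\<^esub>"
    unfolding t_def n_def by (rule bexI)
qed simp

text \<open>That the order of an element lies in the radical does not by itself put its prime
  divisors there, so one passes to powers of prime order. The primes found this way must all
  coincide, being pairwise not coprime.\<close>

lemma p_group_if_kernel_subset_jacobson_radical:
  assumes "carrier G \<noteq> {\<one>\<^bsub>G\<^esub>}"
  shows "\<exists>p. Factorial_Ring.prime p \<and> p_group p G \<and> [p] \<cdot>\<^bsub>R\<^esub> \<one>\<^bsub>R\<^esub> \<in> jacobson_radical R"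
proof -
  have prime_J: "[q] \<cdot>\<^bsub>R\<^esub> \<one>\<^bsub>R\<^esub> \<in> jacobson_radical R"
    if q: "Factorial_Ring.prime q" "q dvd G.ord g" and g: "g \<in> carrier G" for q g
  proof -
    \<comment> \<open>This power of \<open>g\<close> has order exactly \<open>q\<close>, so it is
      not the identity and its order may be placed in the radical.\<close>
    define h where "h = g [^]\<^bsub>G\<^esub> (G.ord g div q)"
    have n0: "G.ord g \<noteq> 0" using ord_neq_zero[OF g] .
    obtain m where m: "G.ord g = q * m" using q(2) by (rule dvdE)
    have "q \<noteq> 0" "m \<noteq> 0" using m n0 by auto
    then have "G.ord h = q"
      using G.ord_pow[OF g, of m] m by (simp add: h_def)
    moreover have "h \<in> carrier G" using g by (simp add: h_def)
    moreover have "h \<noteq> \<one>\<^bsub>G\<^esub>" using \<open>G.ord h = q\<close> q(1) by auto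
    ultimately show ?thesis using ord_in_jacobson_radical[of h] by simp
  qed
  obtain g where g: "g \<in> carrier G" "g \<noteq> \<one>\<^bsub>G\<^esub>" using assms by auto
  then have "G.ord g \<noteq> 1" using G.ord_eq_1 by simp
  then obtain p where p: "Factorial_Ring.prime p" "p dvd G.ord g" using prime_factor_nat by blast
  have pJ: "[p] \<cdot>\<^bsub>R\<^esub> \<one>\<^bsub>R\<^esub> \<in> jacobson_radical R" using prime_J[OF p g(1)] .
  have "\<exists>k. G.ord h = p ^ k" if h: "h \<in> carrier G" for h
  proof (rule prime_power_if_unique_prime[OF ord_neq_zero[OF h] p(1)])
    fix q assume q: "Factorial_Ring.prime q" "q dvd G.ord h"
    show "q = p"
    proof (rule ccontr)
      assume "q \<noteq> p"
      then have "coprime p q" using p(1) q(1) primes_coprime by metis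
      then show False
        using R.coprime_notin_jacobson_radical[OF one_neq_zero _ _ pJ, of q] prime_J[OF q h] p(1) by auto
    qed
  qed
  then show ?thesis using p(1) pJ unfolding p_group_def by blast
qed

end

lemma fine_by_group_ring_imp:
  assumes G: "carrier G \<noteq> {\<one>\<^bsub>G\<^esub>}"
    and fine: "fine_by T RG" and T: "T \<subseteq> Units RG" "\<one>\<^bsub>RG\<^esub> \<in> T"
    and T': "T' \<subseteq> Units R" "augmentation ` T \<subseteq> T'"
  shows "fine_by T' R \<and>
    (\<exists>p. Factorial_Ring.prime p \<and> p_group p G \<and> [p] \<cdot>\<^bsub>R\<^esub> \<one>\<^bsub>R\<^esub> \<in> jacobson_radical R)"
proof
  interpret aug: ring_hom_ring RG R augmentation by (rule augmentation_hom)
  interpret scalar: ring_hom_ring R RG scalar by (rule scalar_hom)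
  \<comment> \<open>If \<open>R\<close> were the zero ring, so would be the group ring, which
    fineness excludes.\<close>
  have ne: "\<one>\<^bsub>R\<^esub> \<noteq> \<zero>\<^bsub>R\<^esub>"
  proof
    assume "\<one>\<^bsub>R\<^esub> = \<zero>\<^bsub>R\<^esub>"
    then have "\<one>\<^bsub>RG\<^esub> = \<zero>\<^bsub>RG\<^esub>" using scalar.hom_one scalar.hom_zero by simp
    then show False using fine RG.fine_by_iff[OF T] by simp
  qed
  have surj: "augmentation ` carrier RG = carrier R"
  proof
    show "augmentation ` carrier RG \<subseteq> carrier R" using augmentation_closed by auto
    show "carrier R \<subseteq> augmentation ` carrier RG"
    proof
      fix r assume "r \<in> carrier R"
      then have "r = augmentation (scalar r)" "scalar r \<in> carrier RG" by (simp_all add: augmentation_monomial)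
      then show "r \<in> augmentation ` carrier RG" by (rule image_eqI)
    qed
  qed
  show "fine_by T' R" by (rule aug.fine_by_image[OF fine T T' surj ne])
  show "\<exists>p. Factorial_Ring.prime p \<and> p_group p G \<and> [p] \<cdot>\<^bsub>R\<^esub> \<one>\<^bsub>R\<^esub> \<in> jacobson_radical R"
    using aug.kernel_subset_jacobson_radical[OF fine T ne]
    by (intro p_group_if_kernel_subset_jacobson_radical[OF ne _ G])
qed

end

theorem theorem2p23:
  fixes R :: "('a, 'm) ring_scheme" and G :: "('g, 'n) monoid_scheme"
  assumes "ring R" and "group G" and "carrier G \<noteq> {\<one>\<^bsub>G\<^esub>}"
  shows
    "(generalized_t_fine (group_ring R G) \<longrightarrow>
        generalized_t_fine R \<and>
        (\<exists>p::nat. Factorial_Ring.prime p \<and> p_group p G \<and> [p] \<cdot>\<^bsub>R\<^esub> \<one>\<^bsub>R\<^esub> \<in> jacobson_radical R)) \<and>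
     (generalized_fine (group_ring R G) \<longrightarrow>
        generalized_fine R \<and>
        (\<exists>p::nat. Factorial_Ring.prime p \<and> p_group p G \<and> [p] \<cdot>\<^bsub>R\<^esub> \<one>\<^bsub>R\<^esub> \<in> jacobson_radical R)) \<and>
     (generalized_t_fine R \<and>
        (\<exists>p::nat. Factorial_Ring.prime p \<and> locally_finite G \<and> p_group p G \<and> [p] \<cdot>\<^bsub>R\<^esub> \<one>\<^bsub>R\<^esub> \<in> nilpotents R) \<longrightarrow>
        generalized_t_fine (group_ring R G)) \<and>
     (generalized_fine R \<and>
        (\<exists>p::nat. Factorial_Ring.prime p \<and> locally_finite G \<and> p_group p G \<and> [p] \<cdot>\<^bsub>R\<^esub> \<one>\<^bsub>R\<^esub> \<in> nilpotents R) \<longrightarrow>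
        generalized_fine (group_ring R G))"
proof -
  interpret R: ring R by fact
  interpret G: group G by fact
  interpret group_ring_context R G
    by (intro group_ring_context.intro R.ring_axioms G.is_group)
  interpret aug: ring_hom_ring RG R augmentation by (rule augmentation_hom)
  interpret scalar: ring_hom_ring R RG scalar by (rule scalar_hom)
  note t = RG.torsion_units_subset R.torsion_units_subset
  note u = order_refl[of "Units RG"] RG.Units_one_closed order_refl[of "Units R"] R.Units_one_closed
  \<comment> \<open>Both kinds of units are preserved by the augmentation and by the scalar
    embedding, so each half of the theorem is one general lemma instantiated twice.\<close>
  have images: "augmentation ` torsion_units RG \<subseteq> torsion_units R" "augmentation ` Units RG \<subseteq> Units R"
    "scalar ` torsion_units R \<subseteq> torsion_units RG" "scalar ` Units R \<subseteq> Units RG"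
    using aug.hom_torsion_units aug.hom_Units scalar.hom_torsion_units scalar.hom_Units by auto
  show ?thesis
    unfolding R.generalized_fine_iff R.generalized_t_fine_iff RG.generalized_fine_iff RG.generalized_t_fine_iff
    using fine_by_group_ring_imp[OF assms(3) _ t(1,2,3) images(1)]
      fine_by_group_ring_imp[OF assms(3) _ u(1,2,3) images(2)]
      fine_by_group_ring[OF _ _ _ _ _ t(3,4,1,2) images(3)]
      fine_by_group_ring[OF _ _ _ _ _ u(3,4,1,2) images(4)]
    by auto
qed

end
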